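(* Fix $T>0$, $x_0\in\mathbb R$, $L>0$, $L_1>0$, $q\ge1$, $H\in(\frac12,1)$, and a kernel $G$ satisfying (A2). Let $\varphi_\epsilon>0$ be a bandwidth with $\varphi_\epsilon\to0$ and $\epsilon^2\varphi_\epsilon^{2H-2}\to0$ as $\epsilon\to0$. For each $\theta\in\Theta_0(L)$ and $\epsilon>0$ let $X$ be the solution of the SDE below and $\widehat{\theta}_tX_t$ the kernel estimator below. Then for any $0<a\le b<T$, $$\lim_{\epsilon\to0}\ \sup_{\theta\in\Theta_0(L)}\ \sup_{a\le t\le b}E_\theta\big[\,|\widehat{\theta}_tX_t-\theta(t)x_t|^2\big]=0 .$$
   Context: Hermite process: let $W=\{W(h),h\in L^2(\mathbb R)\}$ be a centered Gaussian family with $E[W(h)W(g)]=\langle h,g\rangle_{L^2(\mathbb R)}$; for an integer $q\ge1$ and $H\in(\frac12,1)$ set $H_0=1+\frac{H-1}{q}$, $c(q,H)=\sqrt{H(2H-1)/(q!\,\beta(H_0-\frac12,2-2H_0)^q)}$ and $Z^{q,H}_t=c(q,H)\int_{\mathbb R^q}\big(\int_0^t\prod_{j=1}^q(s-\psi_j)_+^{H_0-3/2}ds\big)dW_{\psi_1}\cdots dW_{\psi_q}$ (multiple Wiener–Itô integral; continuous version used). It is centered, $H$-self-similar, has stationary increments and covariance $\frac12(t^{2H}+s^{2H}-|t-s|^{2H})$. For deterministic $f$ with $\int\int|f(u)f(v)||u-v|^{2H-2}dudv<\infty$ the Wiener integral is $\int_{\mathbb R}f\,dZ^{q,H}=c(q,H)\int_{\mathbb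 R^q}\big(\int_{\mathbb R}f(u)\prod_{j=1}^q(u-\psi_j)_+^{H_0-3/2}du\big)dW_{\psi_1}\cdots dW_{\psi_q}$ (and $\int_0^T f\,dZ^{q,H}:=\int_{\mathbb R}f1_{[0,T]}dZ^{q,H}$); it has mean $0$ and $E[\int f dZ^{q,H}\int g dZ^{q,H}]=H(2H-1)\int\int f(u)g(v)|u-v|^{2H-2}dudv$. Model: for $\theta:[0,T]\to\mathbb R$ and $\epsilon>0$, $X$ is the pathwise solution of $X_t=x_0+\int_0^t\theta(s)X_sds+\epsilon Z^{q,H}_t$, $0\le t\le T$ (i.e. $dX_t=\theta(t)X_tdt+\epsilon dZ^{q,H}_t$), and $x_t=x_0\exp(\int_0^t\theta(s)ds)$; $E_\theta$ denotes expectation when $\theta$ is the true multiplier. Classes: for an integer $k\ge0$, $\Theta_k(L)$ is the set of functions $\theta$ with $|\theta(t)|\le L$ for all $t$ (condition (A1)), $k$ times differentiable, with $|\theta^{(k)}(x)-\theta^{(k)}(y)|\le L_1|x-y|$ for all $x,y$ ($\theta^{(0)}=\theta$). Kernel: $G$ is a bounded measurable function with compact support $[A,B]$, $A<0<B$, satisfying (A2): $\int_A^BG(u)du=1$. Estimator: $\widehat{\theta}_tX_t:=\frac1{\varphi_\epsilon}\int_0^TG\big(\frac{\tau-t}{\varphi_\epsilon}\big)dX_\tau=\frac1{\varphi_\epsilon}\int_0^TG\big(\frac{\tau-t}{\varphi_\epsilon}\big)\theta(\tau)X_\tau d\tau+\frac{\epsilon}{\varphi_\epsilon}\int_0^TG\big(\frac{\tau-t}{\varphi_\epsilon}\big)dZ^{q,H}_\tau$.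 *)

theory Defs
  imports "HOL-Probability.Probability"
begin

definition ppow :: "real \<Rightarrow> real \<Rightarrow> real" where
  "ppow x \<alpha> = (if 0 < x then x powr \<alpha> else 0)"

definition H0 :: "nat \<Rightarrow> real \<Rightarrow> real" where
  "H0 q H = 1 + (H - 1) / real q"

definition cqH :: "nat \<Rightarrow> real \<Rightarrow> real" where
  "cqH q H = sqrt (H * (2 * H - 1) / (fact q * Beta (H0 q H - 1/2) (2 - 2 * H0 q H) ^ q))"

fun hermite :: "nat \<Rightarrow> real \<Rightarrow> real" where
  "hermite 0 x = 1"
| "hermite (Suc 0) x = x"
| "hermite (Suc (Suc n)) x = x * hermite (Suc n) x - real (Suc n) * hermite n x"

definition l2fun :: "(real \<Rightarrow> real) \<Rightarrow> bool" where
  "l2fun h \<longleftrightarrow> h \<in> borel_measurable lborel \<and> integrable lborel (\<lambda>x. (h x)^2)"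

definition ip :: "(real \<Rightarrow> real) \<Rightarrow> (real \<Rightarrow> real) \<Rightarrow> real" where
  "ip h g = (\<integral>x. h x * g x \<partial>lborel)"

text \<open>W is a centered Gaussian family indexed by L^2(R) with covariance the L^2 inner
  product (isonormal Gaussian process); joint Gaussianity is expressed through the joint
  moment generating function of every finite subfamily.\<close>
definition isonormal :: "'a measure \<Rightarrow> ((real \<Rightarrow> real) \<Rightarrow> 'a \<Rightarrow> real) \<Rightarrow> bool" where
  "isonormal M W \<longleftrightarrow>
     (\<forall>h. l2fun h \<longrightarrow> W h \<in> borel_measurable M) \<and>
     (\<forall>(n::nat) (hs :: nat \<Rightarrow> real \<Rightarrow> real) (s :: nat \<Rightarrow> real).
        (\<forall>i<n. l2fun (hs i)) \<longrightarrow>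
        (\<integral>\<omega>. exp (\<Sum>i<n. s i * W (hs i) \<omega>) \<partial>M)
          = exp ((\<Sum>i<n. \<Sum>j<n. s i * s j * ip (hs i) (hs j)) / 2))"

text \<open>Y is (a version of) the multiple Wiener-Ito integral I_q(f) of the kernel
  f in L^2(R^q): Y lies in the q-th Wiener chaos (the L^2-closure of the span of
  He_q(W h), |h| = 1) and E[Y He_q(W h)] = q! <f, h^{\<otimes>q}> for all unit h
  (recall I_q(h^{\<otimes>q}) = He_q(W h) for unit h). These properties determine Y a.s.\<close>
definition chaos_integral ::
  "'a measure \<Rightarrow> ((real \<Rightarrow> real) \<Rightarrow> 'a \<Rightarrow> real) \<Rightarrow> nat \<Rightarrow> ((nat \<Rightarrow> real) \<Rightarrow> real) \<Rightarrow> ('a \<Rightarrow> real) \<Rightarrow> bool"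
where
  "chaos_integral M W q f Y \<longleftrightarrow>
     Y \<in> borel_measurable M \<and> integrable M (\<lambda>\<omega>. (Y \<omega>)^2) \<and>
     (\<forall>h. l2fun h \<and> ip h h = 1 \<longrightarrow>
        (\<integral>\<omega>. Y \<omega> * hermite q (W h \<omega>) \<partial>M)
          = fact q * (\<integral>\<psi>. f \<psi> * (\<Prod>j<q. h (\<psi> j)) \<partial>(PiM {..<q} (\<lambda>_. lborel)))) \<and>
     (\<forall>\<delta>>0. \<exists>(n::nat) (c :: nat \<Rightarrow> real) (hs :: nat \<Rightarrow> real \<Rightarrow> real).
        (\<forall>i<n. l2fun (hs i) \<and> ip (hs i) (hs i) = 1) \<and>
        (\<integral>\<omega>. (Y \<omega> - (\<Sum>i<n. c i * hermite q (W (hs i) \<omega>)))^2 \<partial>M) < \<delta>)"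

definition hermite_kernel :: "nat \<Rightarrow> real \<Rightarrow> (real \<Rightarrow> real) \<Rightarrow> (nat \<Rightarrow> real) \<Rightarrow> real" where
  "hermite_kernel q H f \<psi> = (\<integral>u. f u * (\<Prod>j<q. ppow (u - \<psi> j) (H0 q H - 3/2)) \<partial>lborel)"

definition hermite_wiener ::
  "'a measure \<Rightarrow> ((real \<Rightarrow> real) \<Rightarrow> 'a \<Rightarrow> real) \<Rightarrow> nat \<Rightarrow> real \<Rightarrow> (real \<Rightarrow> real) \<Rightarrow> ('a \<Rightarrow> real) \<Rightarrow> bool"
where
  "hermite_wiener M W q H f V \<longleftrightarrow>
     V \<in> borel_measurable M \<and>
     (\<exists>Y. chaos_integral M W q (hermite_kernel q H f) Y \<and> (AE \<omega> in M. V \<omega> = cqH q H * Y \<omega>))"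

definition wiener_admissible :: "real \<Rightarrow> (real \<Rightarrow> real) \<Rightarrow> bool" where
  "wiener_admissible H f \<longleftrightarrow> f \<in> borel_measurable lborel \<and>
     (\<integral>\<^sup>+ p. ennreal (\<bar>f (fst p) * f (snd p)\<bar> * \<bar>fst p - snd p\<bar> powr (2 * H - 2)) \<partial>(lborel \<Otimes>\<^sub>M lborel)) < \<infinity>"

definition Theta0 :: "real \<Rightarrow> real \<Rightarrow> (real \<Rightarrow> real) set" where
  "Theta0 L L1 = {\<theta>. (\<forall>t. \<bar>\<theta> t\<bar> \<le> L) \<and> (\<forall>x y. \<bar>\<theta> x - \<theta> y\<bar> \<le> L1 * \<bar>x - y\<bar>)}"

end

theory Submission
  imports Defs
begin

text \<open>The error splits into three parts: the kernel average of \<open>\<theta> (X - x)\<close>, the stochastic integral of the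
  kernel, and the deterministic smoothing bias, which is of order \<open>\<phi>\<close>. By Gronwall \<open>X - x\<close> is pathwise
  controlled by \<open>\<epsilon>\<close> times \<open>|Z|\<close> and its time integral, so the first part is of order \<open>\<epsilon>\<close> in \<open>L\<^sup>2\<close>. For the
  second part only an upper bound on the variance of Wiener integrals is needed: orthogonality of
  Hermite polynomials gives \<open>E[I\<^sub>q(k)\<^sup>2] \<le> q! |k|\<^sup>2\<close>, and integrating out the \<open>\<psi>\<^sub>j\<close> bounds the norm of the Hermite
  kernel of \<open>f\<close> by a multiple of the double integral of \<open>|f(u) f(v)| |u - v|\<close> to the power \<open>2 H - 2\<close>. For \<open>f\<close> bounded on an
  interval of length \<open>l\<close> this is of order \<open>l\<close> to the power \<open>2 H\<close>, whence a contribution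
  \<open>\<epsilon>\<^sup>2\<close> times \<open>\<phi>\<close> to the power \<open>2 H - 2\<close>.\<close>


section \<open>Hermite polynomials of correlated Gaussian variables\<close>

text \<open>\<open>chaos_integral\<close> determines its variable only through pairings with
  \<open>He_q(W h)\<close> and approximability by their linear combinations, so no isometry for
  multiple integrals is at hand. An inequality follows directly from these two properties, and an
  upper bound suffices for consistency. The variance bound gives second moments of Z at fixed times,
  not of its running maximum. Hence Z is finally met only inside time integrals. This also settles
  the prefactor 1/phi in front of the kernel average: by Cauchy-Schwarz in time, the integral of |Z|
  over a window of length (B - A) phi has second moment of order phi^2, which cancels the square of
  that prefactor. Keeping t in [a, b], away from 0 and T, places the whole window inside [0, T] once
  phi is small, so the kernel keeps its full mass 1 there.\<close>

lemma has_field_derivative_integral_dominated: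
  fixes f f' :: "real \<Rightarrow> 'a \<Rightarrow> real" and g :: "'a \<Rightarrow> real"
  assumes d: "d > 0"
    and int: "\<And>s. \<bar>s - s0\<bar> < d \<Longrightarrow> integrable M (f s)"
    and meas: "f' s0 \<in> borel_measurable M"
    and deriv: "\<And>s x. \<bar>s - s0\<bar> < d \<Longrightarrow> ((\<lambda>s. f s x) has_field_derivative f' s x) (at s)"
    and bound: "\<And>s x. \<bar>s - s0\<bar> < d \<Longrightarrow> \<bar>f' s x\<bar> \<le> g x"
    and g: "integrable M g"
  shows "((\<lambda>s. \<integral>x. f s x \<partial>M) has_field_derivative (\<integral>x. f' s0 x \<partial>M)) (at s0)"
  unfolding DERIV_def tendsto_at_iff_sequentially
proof (intro allI impI)
  fix h :: "nat \<Rightarrow> real"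
  assume h0: "\<forall>i. h i \<in> UNIV - {0}" and h: "h \<longlonglongrightarrow> 0"
  have "\<forall>\<^sub>F i in sequentially. dist (h i) 0 < d"
    using h d by (rule tendstoD)
  then obtain N where N: "\<And>i. i \<ge> N \<Longrightarrow> \<bar>h i\<bar> < d"
    by (auto simp: eventually_sequentially dist_real_def)
  \<comment> \<open>Dominated convergence asks for the bound at every index, so the finitely many
    increments that may leave the ball are shifted away.\<close>
  define k where "k i = h (i + N)" for i
  have k0: "k i \<noteq> 0" and kd: "\<bar>k i\<bar> < d" for i using h0 N by (auto simp: k_def)
  have k: "k \<longlonglongrightarrow> 0" unfolding k_def by (rule LIMSEQ_ignore_initial_segment[OF h])
  have int0: "integrable M (f s0)" using int[of s0] d by simp
  have intk: "integrable M (f (s0 + k i))" for i using int[of "s0 + k i"] kd by simp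
  have "(\<lambda>i. \<integral>x. (f (s0 + k i) x - f s0 x) / k i \<partial>M) \<longlonglongrightarrow> (\<integral>x. f' s0 x \<partial>M)"
  proof (rule integral_dominated_convergence[where w = g])
    show "f' s0 \<in> borel_measurable M" by (rule meas)
    show "(\<lambda>x. (f (s0 + k i) x - f s0 x) / k i) \<in> borel_measurable M" for i
      using intk[of i] int0 by (intro borel_measurable_divide borel_measurable_diff) auto
    show "integrable M g" by (rule g)
    show "AE x in M. (\<lambda>i. (f (s0 + k i) x - f s0 x) / k i) \<longlonglongrightarrow> f' s0 x"
    proof (rule AE_I2)
      fix x
      have "((\<lambda>s. f s x) has_field_derivative f' s0 x) (at s0)" using deriv[of s0] d by simp
      then show "(\<lambda>i. (f (s0 + k i) x - f s0 x) / k i) \<longlonglongrightarrow> f' s0 x"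
        unfolding DERIV_def tendsto_at_iff_sequentially using k k0 by (auto simp: o_def)
    qed
    show "AE x in M. norm ((f (s0 + k i) x - f s0 x) / k i) \<le> g x" for i
    proof (rule AE_I2)
      fix x
      \<comment> \<open>The mean value inequality on the ball turns the bound on the derivative into
        a bound on the difference quotient.\<close>
      have "norm (f (s0 + k i) x - f s0 x) \<le> g x * norm (s0 + k i - s0)"
      proof (rule field_differentiable_bound[where S = "ball s0 d" and f = "\<lambda>s. f s x" and f' = "\<lambda>s. f' s x"])
        show "((\<lambda>s. f s x) has_field_derivative f' z x) (at z within ball s0 d)" if "z \<in> ball s0 d" for z
          using that deriv[of z x] by (auto simp: dist_real_def abs_minus_commute intro: DERIV_subset)
        show "norm (f' z x) \<le> g x" if "z \<in> ball s0 d" for z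
          using that bound[of z x] by (auto simp: dist_real_def abs_minus_commute)
      qed (use d kd[of i] in \<open>auto simp: dist_real_def\<close>)
      then show "norm ((f (s0 + k i) x - f s0 x) / k i) \<le> g x"
        using k0[of i] by (simp add: divide_simps)
    qed
  qed
  moreover have eq: "(\<integral>x. (f (s0 + k i) x - f s0 x) / k i \<partial>M)
      = ((\<integral>x. f (s0 + k i) x \<partial>M) - (\<integral>x. f s0 x \<partial>M)) / k i" for i
    using intk[of i] int0 by simp
  ultimately have "(\<lambda>i. ((\<integral>x. f (s0 + k i) x \<partial>M) - (\<integral>x. f s0 x \<partial>M)) / k i) \<longlonglongrightarrow> (\<integral>x. f' s0 x \<partial>M)"
    unfolding eq by blast
  then show "((\<lambda>h. ((\<integral>x. f (s0 + h) x \<partial>M) - (\<integral>x. f s0 x \<partial>M)) / h) \<circ> h) \<longlonglongrightarrow> (\<integral>x. f' s0 x \<partial>M)"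
    unfolding k_def o_def by (rule LIMSEQ_offset)
qed

section \<open>Hermite polynomials: recursion, derivative, growth and generating function\<close>

lemma hermite_Suc: "hermite (Suc n) x = x * hermite n x - real n * hermite (n - 1) x"
  by (cases n) auto

lemma has_field_derivative_hermite:
  "(hermite n has_field_derivative (real n * hermite (n - 1) x)) (at x)"
proof (induction n arbitrary: x rule: less_induct)
  case (less n)
  consider "n = 0" | "n = 1" | m where "n = Suc (Suc m)"
    by (metis One_nat_def not0_implies_Suc)
  then show ?case
  proof cases
    case 1
    then have "hermite n = (\<lambda>_. 1)" by (auto simp: fun_eq_iff)
    then show ?thesis using 1 by simp
  next
    case 2
    then have "hermite n = (\<lambda>x. x)" by (auto simp: fun_eq_iff)
    then show ?thesis using 2 by simp
  next
    case 3
    have eq: "hermite n = (\<lambda>x. x * hermite (Suc m) x - real (Suc m) * hermite m x)"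
      using 3 by (auto simp: fun_eq_iff)
    have 1: "(hermite (Suc m) has_field_derivative (real (Suc m) * hermite m x)) (at x)"
      using less.IH[of "Suc m" x] 3 by simp
    have 2: "(hermite m has_field_derivative (real m * hermite (m - 1) x)) (at x)"
      using less.IH[of m x] 3 by simp
    have "(hermite n has_field_derivative
      (1 * hermite (Suc m) x + real (Suc m) * hermite m x * x - real (Suc m) * (real m * hermite (m - 1) x))) (at x)"
      unfolding eq by (rule DERIV_diff[OF DERIV_mult[OF DERIV_ident 1] DERIV_cmult[OF 2]])
    moreover have "1 * hermite (Suc m) x + real (Suc m) * hermite m x * x - real (Suc m) * (real m * hermite (m - 1) x)
        = real n * hermite (n - 1) x"
    proof -
      \<comment> \<open>The recursion read backwards eliminates the lowest polynomial; for
        \<open>m = 0\<close> the truncated \<open>m - 1\<close> is harmless because its coefficient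
        vanishes.\<close>
      have e: "real m * hermite (m - 1) x = x * hermite m x - hermite (Suc m) x"
        using hermite_Suc[of m x] by simp
      show ?thesis unfolding e by (simp add: 3 algebra_simps)
    qed
    ultimately show ?thesis by simp
  qed
qed

lemma continuous_on_hermite: "continuous_on A (hermite n)"
  by (meson has_field_derivative_hermite DERIV_isCont continuous_at_imp_continuous_on)

lemma borel_measurable_hermite [measurable]: "hermite n \<in> borel_measurable borel"
  by (rule borel_measurable_continuous_onI[OF continuous_on_hermite])

text \<open>An exponential bound, cruder than the polynomial one, since it will be paired with
  exponential moments. Each factor \<open>x\<close> of the recursion is absorbed by
  \<open>|x| \<le> exp |x|\<close>, which raises the exponent by one.\<close>

lemma hermite_bound: "\<exists>C\<ge>0. \<forall>x. \<bar>hermite n x\<bar> \<le> C * exp (real n * \<bar>x\<bar>)"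
proof (induction n rule: less_induct)
  case (less n)
  show ?case
  proof (cases n)
    case 0
    then show ?thesis by (intro exI[of _ 1]) auto
  next
    case (Suc m)
    obtain C where C: "C \<ge> 0" "\<And>x. \<bar>hermite m x\<bar> \<le> C * exp (real m * \<bar>x\<bar>)"
      using less.IH[of m] Suc by auto
    have "m - 1 < n" using Suc by simp
    from less.IH[OF this] obtain D where D: "D \<ge> 0" "\<And>x. \<bar>hermite (m - 1) x\<bar> \<le> D * exp (real (m - 1) * \<bar>x\<bar>)"
      by auto
    show ?thesis
    proof (intro exI[of _ "C + real m * D"] conjI allI)
      show "0 \<le> C + real m * D" using C D by simp
      fix x :: real
      have "\<bar>hermite n x\<bar> \<le> \<bar>x\<bar> * \<bar>hermite m x\<bar> + real m * \<bar>hermite (m - 1) x\<bar>"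
        unfolding Suc hermite_Suc[of m x] by (metis abs_mult abs_of_nat abs_triangle_ineq4)
      also have "\<dots> \<le> exp \<bar>x\<bar> * (C * exp (real m * \<bar>x\<bar>)) + real m * (D * exp (real n * \<bar>x\<bar>))"
      proof (intro add_mono mult_mono order.trans[OF D(2)])
        show "\<bar>x\<bar> \<le> exp \<bar>x\<bar>" using exp_ge_add_one_self[of "\<bar>x\<bar>"] by linarith
        show "exp (real (m - 1) * \<bar>x\<bar>) \<le> exp (real n * \<bar>x\<bar>)"
          using Suc by (auto intro!: mult_right_mono)
      qed (use C D in auto)
      also have "\<dots> = (C + real m * D) * exp (real n * \<bar>x\<bar>)"
        by (simp add: Suc exp_add[symmetric] algebra_simps)
      finally show "\<bar>hermite n x\<bar> \<le> (C + real m * D) * exp (real n * \<bar>x\<bar>)" .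
    qed
  qed
qed

text \<open>The product rule produces \<open>(x - s) He_n(x - s) - n He_(n-1)(x - s)\<close>, which
  the recursion turns into \<open>He_(n+1)(x - s)\<close>. Thus the n-th derivative of
  \<open>exp (s x - s^2/2)\<close> at \<open>s = 0\<close> is \<open>He_n(x)\<close>.\<close>

lemma has_field_derivative_hermite_exp:
  "((\<lambda>s. hermite n (x - s) * exp (s * x - s^2 / 2)) has_field_derivative
     hermite (Suc n) (x - s) * exp (s * x - s^2 / 2)) (at s)"
proof -
  have "((\<lambda>s. hermite n (x - s)) has_field_derivative real n * hermite (n - 1) (x - s) * (- 1)) (at s)"
    by (rule DERIV_chain2[OF has_field_derivative_hermite]) (auto intro!: derivative_eq_intros)
  moreover have "((\<lambda>s. exp (s * x - s^2 / 2)) has_field_derivative exp (s * x - s^2 / 2) * (x - s)) (at s)"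
    by (auto intro!: derivative_eq_intros)
  ultimately show ?thesis
    by (rule DERIV_mult[THEN DERIV_cong]) (simp only: hermite_Suc, simp add: algebra_simps)
qed

text \<open>Uniformity in \<open>s\<close> is the point: differentiation under the integral needs
  one dominating function for a whole neighbourhood.\<close>

lemma hermite_exp_bound:
  assumes "R \<ge> 0"
  shows "\<exists>C\<ge>0. \<forall>s x. \<bar>s\<bar> \<le> R \<longrightarrow>
    \<bar>hermite n (x - s) * exp (s * x - s^2 / 2)\<bar> \<le> C * exp ((real n + R) * \<bar>x\<bar>)"
proof -
  obtain C where C: "C \<ge> 0" "\<And>x. \<bar>hermite n x\<bar> \<le> C * exp (real n * \<bar>x\<bar>)"
    using hermite_bound by auto
  show ?thesis
  proof (intro exI[of _ "C * exp (real n * R)"] conjI allI impI)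
    show "0 \<le> C * exp (real n * R)" using C by simp
    fix s x :: real assume s: "\<bar>s\<bar> \<le> R"
    have "\<bar>hermite n (x - s) * exp (s * x - s^2 / 2)\<bar> = \<bar>hermite n (x - s)\<bar> * exp (s * x - s^2 / 2)"
      by (simp add: abs_mult)
    also have "\<dots> \<le> (C * exp (real n * (\<bar>x\<bar> + R))) * exp (R * \<bar>x\<bar>)"
    proof (intro mult_mono order.trans[OF C(2)])
      show "exp (real n * \<bar>x - s\<bar>) \<le> exp (real n * (\<bar>x\<bar> + R))"
        using s by (auto intro!: mult_left_mono)
      have "s * x \<le> \<bar>s\<bar> * \<bar>x\<bar>" by (metis abs_ge_self abs_mult)
      also have "\<dots> \<le> R * \<bar>x\<bar>" using s by (intro mult_right_mono) auto
      finally show "exp (s * x - s^2 / 2) \<le> exp (R * \<bar>x\<bar>)"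
        using zero_le_power2[of s] unfolding exp_le_cancel_iff by linarith
    qed (use C in auto)
    also have "\<dots> = C * exp (real n * R) * exp ((real n + R) * \<bar>x\<bar>)"
      by (simp add: exp_add[symmetric] algebra_simps)
    finally show "\<bar>hermite n (x - s) * exp (s * x - s^2 / 2)\<bar> \<le> C * exp (real n * R) * exp ((real n + R) * \<bar>x\<bar>)" .
  qed
qed

lemma integrable_hermite_exp:
  fixes X F :: "'a \<Rightarrow> real"
  assumes [measurable]: "X \<in> borel_measurable M" "F \<in> borel_measurable M"
    and F: "\<And>k. integrable M (\<lambda>\<omega>. \<bar>F \<omega>\<bar> * exp (k * \<bar>X \<omega>\<bar>))"
  shows "integrable M (\<lambda>\<omega>. F \<omega> * (hermite n (X \<omega> - s) * exp (s * X \<omega> - s^2 / 2)))"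
proof -
  obtain C where C: "C \<ge> 0" "\<And>x. \<bar>hermite n (x - s) * exp (s * x - s^2 / 2)\<bar> \<le> C * exp ((real n + \<bar>s\<bar>) * \<bar>x\<bar>)"
    using hermite_exp_bound[of "\<bar>s\<bar>" n] by auto
  show ?thesis
  proof (rule Bochner_Integration.integrable_bound)
    show "integrable M (\<lambda>\<omega>. C * (\<bar>F \<omega>\<bar> * exp ((real n + \<bar>s\<bar>) * \<bar>X \<omega>\<bar>)))"
      by (intro integrable_mult_right F)
    show "AE \<omega> in M. norm (F \<omega> * (hermite n (X \<omega> - s) * exp (s * X \<omega> - s^2 / 2)))
        \<le> norm (C * (\<bar>F \<omega>\<bar> * exp ((real n + \<bar>s\<bar>) * \<bar>X \<omega>\<bar>)))"
    proof (rule AE_I2)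
      fix \<omega>
      have "\<bar>F \<omega>\<bar> * \<bar>hermite n (X \<omega> - s) * exp (s * X \<omega> - s^2 / 2)\<bar> \<le> \<bar>F \<omega>\<bar> * (C * exp ((real n + \<bar>s\<bar>) * \<bar>X \<omega>\<bar>))"
        by (intro mult_left_mono C) auto
      then show "norm (F \<omega> * (hermite n (X \<omega> - s) * exp (s * X \<omega> - s^2 / 2)))
        \<le> norm (C * (\<bar>F \<omega>\<bar> * exp ((real n + \<bar>s\<bar>) * \<bar>X \<omega>\<bar>)))"
        using C(1) by (simp add: abs_mult mult_ac)
    qed
  qed measurable
qed

lemma has_field_derivative_integral_hermite_exp:
  fixes X F :: "'a \<Rightarrow> real"
  assumes meas [measurable]: "X \<in> borel_measurable M" "F \<in> borel_measurable M"
    and F: "\<And>k. integrable M (\<lambda>\<omega>. \<bar>F \<omega>\<bar> * exp (k * \<bar>X \<omega>\<bar>))"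
  shows "((\<lambda>s. \<integral>\<omega>. F \<omega> * (hermite n (X \<omega> - s) * exp (s * X \<omega> - s^2 / 2)) \<partial>M) has_field_derivative
     (\<integral>\<omega>. F \<omega> * (hermite (Suc n) (X \<omega> - s) * exp (s * X \<omega> - s^2 / 2)) \<partial>M)) (at s)"
proof -
  define R where "R = \<bar>s\<bar> + 1"
  obtain C where C: "C \<ge> 0" "\<And>t x. \<bar>t\<bar> \<le> R \<Longrightarrow>
      \<bar>hermite (Suc n) (x - t) * exp (t * x - t^2 / 2)\<bar> \<le> C * exp ((real (Suc n) + R) * \<bar>x\<bar>)"
    using hermite_exp_bound[of R "Suc n"] by (auto simp: R_def)
  show ?thesis
  proof (rule has_field_derivative_integral_dominated[where d = 1
        and g = "\<lambda>\<omega>. C * (\<bar>F \<omega>\<bar> * exp ((real (Suc n) + R) * \<bar>X \<omega>\<bar>))"])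
    show "integrable M (\<lambda>\<omega>. F \<omega> * (hermite n (X \<omega> - t) * exp (t * X \<omega> - t^2 / 2)))" for t
      by (rule integrable_hermite_exp[OF meas F])
    show "((\<lambda>t. F \<omega> * (hermite n (X \<omega> - t) * exp (t * X \<omega> - t^2 / 2))) has_field_derivative
        F \<omega> * (hermite (Suc n) (X \<omega> - t) * exp (t * X \<omega> - t^2 / 2))) (at t)" for t \<omega>
      by (rule DERIV_cmult[OF has_field_derivative_hermite_exp])
    show "\<bar>F \<omega> * (hermite (Suc n) (X \<omega> - t) * exp (t * X \<omega> - t^2 / 2))\<bar>
        \<le> C * (\<bar>F \<omega>\<bar> * exp ((real (Suc n) + R) * \<bar>X \<omega>\<bar>))" if "\<bar>t - s\<bar> < 1" for t \<omega>
    proof -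
      have "\<bar>t\<bar> \<le> R" using that by (auto simp: R_def)
      from mult_left_mono[OF C(2)[OF this, of "X \<omega>"], of "\<bar>F \<omega>\<bar>"]
      show ?thesis by (simp add: abs_mult mult_ac)
    qed
    show "integrable M (\<lambda>\<omega>. C * (\<bar>F \<omega>\<bar> * exp ((real (Suc n) + R) * \<bar>X \<omega>\<bar>)))"
      by (intro integrable_mult_right F)
  qed auto
qed

text \<open>The weight \<open>F\<close> lets one formula serve twice: with an exponential of the
  other variable, and then with a Hermite polynomial of it.\<close>

lemma higher_deriv_integral_exp:
  fixes X F :: "'a \<Rightarrow> real"
  assumes "X \<in> borel_measurable M" "F \<in> borel_measurable M"
    and "\<And>k. integrable M (\<lambda>\<omega>. \<bar>F \<omega>\<bar> * exp (k * \<bar>X \<omega>\<bar>))"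
  shows "(deriv ^^ n) (\<lambda>s. \<integral>\<omega>. F \<omega> * exp (s * X \<omega> - s^2 / 2) \<partial>M)
    = (\<lambda>s. \<integral>\<omega>. F \<omega> * (hermite n (X \<omega> - s) * exp (s * X \<omega> - s^2 / 2)) \<partial>M)"
proof (induction n)
  case (Suc n)
  show ?case
    by (simp only: funpow.simps o_def Suc)
      (rule ext, rule DERIV_imp_deriv, rule has_field_derivative_integral_hermite_exp[OF assms])
qed simp

lemma higher_deriv_exp_mult: "(deriv ^^ n) (\<lambda>s::real. exp (s * c)) = (\<lambda>s. c ^ n * exp (s * c))"
proof (induction n)
  case (Suc n)
  have "((\<lambda>s. c ^ n * exp (s * c)) has_field_derivative c ^ Suc n * exp (s * c)) (at s)" for s :: real
    by (auto intro!: derivative_eq_intros)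
  then show ?case
    using Suc by (auto intro!: DERIV_imp_deriv)
qed simp

lemma higher_deriv_monomial: "(deriv ^^ n) (\<lambda>t::real. c * t ^ n) = (\<lambda>t. c * fact n)"
proof (induction n arbitrary: c)
  case (Suc n)
  have "deriv (\<lambda>t::real. c * t ^ Suc n) = (\<lambda>t. (c * real (Suc n)) * t ^ n)"
  proof
    fix t :: real
    have "((\<lambda>t. c * t ^ Suc n) has_field_derivative (c * real (Suc n)) * t ^ n) (at t)"
      by (auto intro!: derivative_eq_intros simp del: power_Suc)
    then show "deriv (\<lambda>t::real. c * t ^ Suc n) t = (c * real (Suc n)) * t ^ n"
      by (rule DERIV_imp_deriv)
  qed
  then show ?case
    \<comment> \<open>The innermost derivative is peeled off, which changes the coefficient; hence
      the induction over arbitrary \<open>c\<close>.\<close>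
    by (simp only: funpow_Suc_right o_def Suc) (simp add: algebra_simps)
qed simp

text \<open>Two standard Gaussian variables with correlation \<rho>. Their joint law is encoded by
  its moment generating function alone, the form in which \<open>isonormal\<close> provides it and
  in which Hermite moments are extracted by differentiation.\<close>

locale gaussian_pair = prob_space M for M :: "'a measure" +
  fixes X Y :: "'a \<Rightarrow> real" and \<rho> :: real
  assumes X_meas [measurable]: "X \<in> borel_measurable M"
    and Y_meas [measurable]: "Y \<in> borel_measurable M"
    and mgf: "(\<integral>\<omega>. exp (s * X \<omega> + t * Y \<omega>) \<partial>M) = exp ((s^2 + 2 * s * t * \<rho> + t^2) / 2)"
begin

text \<open>The Bochner integral of a non-integrable function is 0 by convention, whereas the
  generating function is positive; so the formula itself forces integrability.\<close>

lemma integrable_exp: "integrable M (\<lambda>\<omega>. exp (s * X \<omega> + t * Y \<omega>))"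
proof (rule ccontr)
  assume "\<not> ?thesis"
  then have "(\<integral>\<omega>. exp (s * X \<omega> + t * Y \<omega>) \<partial>M) = 0" by (rule not_integrable_integral_eq)
  then show False using mgf[of s t] by simp
qed

text \<open>Pointwise, the exponential with absolute values is one of the four sign choices, and the
  other three are positive.\<close>

lemma integrable_exp_abs: "integrable M (\<lambda>\<omega>. exp (k * \<bar>X \<omega>\<bar> + l * \<bar>Y \<omega>\<bar>))"
proof (rule Bochner_Integration.integrable_bound)
  show "integrable M (\<lambda>\<omega>. exp (k * X \<omega> + l * Y \<omega>) + exp (k * X \<omega> + (-l) * Y \<omega>)
      + exp ((-k) * X \<omega> + l * Y \<omega>) + exp ((-k) * X \<omega> + (-l) * Y \<omega>))"
    by (intro Bochner_Integration.integrable_add integrable_exp)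
  show "AE \<omega> in M. norm (exp (k * \<bar>X \<omega>\<bar> + l * \<bar>Y \<omega>\<bar>)) \<le> norm (exp (k * X \<omega> + l * Y \<omega>) + exp (k * X \<omega> + (-l) * Y \<omega>)
      + exp ((-k) * X \<omega> + l * Y \<omega>) + exp ((-k) * X \<omega> + (-l) * Y \<omega>))"
  proof (rule AE_I2)
    fix \<omega>
    have "exp (k * \<bar>X \<omega>\<bar> + l * \<bar>Y \<omega>\<bar>) \<in> {exp (k * X \<omega> + l * Y \<omega>), exp (k * X \<omega> + (-l) * Y \<omega>),
        exp ((-k) * X \<omega> + l * Y \<omega>), exp ((-k) * X \<omega> + (-l) * Y \<omega>)}"
      by (auto simp: abs_if)
    moreover have "exp (k * X \<omega> + l * Y \<omega>) > 0" "exp (k * X \<omega> + (-l) * Y \<omega>) > 0"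
      "exp ((-k) * X \<omega> + l * Y \<omega>) > 0" "exp ((-k) * X \<omega> + (-l) * Y \<omega>) > 0"
      by simp_all
    ultimately show "norm (exp (k * \<bar>X \<omega>\<bar> + l * \<bar>Y \<omega>\<bar>)) \<le> norm (exp (k * X \<omega> + l * Y \<omega>) + exp (k * X \<omega> + (-l) * Y \<omega>)
      + exp ((-k) * X \<omega> + l * Y \<omega>) + exp ((-k) * X \<omega> + (-l) * Y \<omega>))"
      unfolding real_norm_def by (auto simp del: exp_gt_zero)
  qed
qed measurable

lemma integrable_hermite_mult: "integrable M (\<lambda>\<omega>. hermite m (X \<omega>) * hermite n (Y \<omega>))"
proof -
  obtain C where C: "C \<ge> 0" "\<And>x. \<bar>hermite m x\<bar> \<le> C * exp (real m * \<bar>x\<bar>)"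
    using hermite_bound by auto
  obtain D where D: "D \<ge> 0" "\<And>x. \<bar>hermite n x\<bar> \<le> D * exp (real n * \<bar>x\<bar>)"
    using hermite_bound by auto
  show ?thesis
  proof (rule Bochner_Integration.integrable_bound)
    show "integrable M (\<lambda>\<omega>. (C * D) * exp (real m * \<bar>X \<omega>\<bar> + real n * \<bar>Y \<omega>\<bar>))"
      by (intro integrable_mult_right integrable_exp_abs)
    show "AE \<omega> in M. norm (hermite m (X \<omega>) * hermite n (Y \<omega>)) \<le> norm ((C * D) * exp (real m * \<bar>X \<omega>\<bar> + real n * \<bar>Y \<omega>\<bar>))"
    proof (rule AE_I2)
      fix \<omega>
      have "\<bar>hermite m (X \<omega>)\<bar> * \<bar>hermite n (Y \<omega>)\<bar> \<le> (C * exp (real m * \<bar>X \<omega>\<bar>)) * (D * exp (real n * \<bar>Y \<omega>\<bar>))"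
        by (intro mult_mono C D) (use C in auto)
      then show "norm (hermite m (X \<omega>) * hermite n (Y \<omega>)) \<le> norm ((C * D) * exp (real m * \<bar>X \<omega>\<bar> + real n * \<bar>Y \<omega>\<bar>))"
        using C D by (simp add: abs_mult exp_add mult_ac)
    qed
  qed measurable
qed

text \<open>Both moments are read off as derivatives at 0 of
  \<open>E[exp (s X - s\<^sup>2/2) exp (t Y - t\<^sup>2/2)] = exp (s t \<rho>)\<close>, first in \<open>s\<close> and then in \<open>t\<close>.\<close>

lemma expectation_hermite_exp:
  "(\<integral>\<omega>. hermite n (X \<omega>) * exp (t * Y \<omega> - t^2 / 2) \<partial>M) = \<rho> ^ n * t ^ n"
proof -
  define F where "F \<omega> = exp (t * Y \<omega> - t^2 / 2)" for \<omega>
  have F [measurable]: "F \<in> borel_measurable M" unfolding F_def by measurable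
  have int: "integrable M (\<lambda>\<omega>. \<bar>F \<omega>\<bar> * exp (k * \<bar>X \<omega>\<bar>))" for k
  proof (rule Bochner_Integration.integrable_bound)
    show "integrable M (\<lambda>\<omega>. exp (k * \<bar>X \<omega>\<bar> + \<bar>t\<bar> * \<bar>Y \<omega>\<bar>))" by (rule integrable_exp_abs)
    have "t * Y \<omega> - t^2 / 2 \<le> \<bar>t\<bar> * \<bar>Y \<omega>\<bar>" for \<omega>
      using abs_ge_self[of "t * Y \<omega>"] zero_le_power2[of t] unfolding abs_mult by linarith
    then show "AE \<omega> in M. norm (\<bar>F \<omega>\<bar> * exp (k * \<bar>X \<omega>\<bar>)) \<le> norm (exp (k * \<bar>X \<omega>\<bar> + \<bar>t\<bar> * \<bar>Y \<omega>\<bar>))"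
      by (auto simp: F_def exp_add[symmetric])
  qed measurable
  have "(\<integral>\<omega>. F \<omega> * exp (s * X \<omega> - s^2 / 2) \<partial>M) = exp (s * (t * \<rho>))" for s
  proof -
    have "(\<integral>\<omega>. F \<omega> * exp (s * X \<omega> - s^2 / 2) \<partial>M)
        = (\<integral>\<omega>. exp (- (s^2 + t^2) / 2) * exp (s * X \<omega> + t * Y \<omega>) \<partial>M)"
      by (intro Bochner_Integration.integral_cong) (auto simp: F_def exp_add[symmetric] field_simps)
    also have "\<dots> = exp (- (s^2 + t^2) / 2) * exp ((s^2 + 2 * s * t * \<rho> + t^2) / 2)"
      by (simp add: mgf)
    also have "\<dots> = exp (s * (t * \<rho>))" by (simp add: exp_add[symmetric] field_simps)
    finally show ?thesis .
  qed
  with higher_deriv_integral_exp[OF X_meas F int, of n] higher_deriv_exp_mult[of n "t * \<rho>"]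
  have "(\<lambda>s. \<integral>\<omega>. F \<omega> * (hermite n (X \<omega> - s) * exp (s * X \<omega> - s^2 / 2)) \<partial>M) = (\<lambda>s. (t * \<rho>) ^ n * exp (s * (t * \<rho>)))"
    by simp
  from fun_cong[OF this, of 0] show ?thesis
    by (simp add: F_def power_mult_distrib mult_ac)
qed

lemma expectation_hermite_mult:
  "(\<integral>\<omega>. hermite n (X \<omega>) * hermite n (Y \<omega>) \<partial>M) = fact n * \<rho> ^ n"
proof -
  have int: "integrable M (\<lambda>\<omega>. \<bar>hermite n (X \<omega>)\<bar> * exp (k * \<bar>Y \<omega>\<bar>))" for k
  proof -
    obtain C where C: "C \<ge> 0" "\<And>x. \<bar>hermite n x\<bar> \<le> C * exp (real n * \<bar>x\<bar>)"
      using hermite_bound by auto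
    show ?thesis
    proof (rule Bochner_Integration.integrable_bound)
      show "integrable M (\<lambda>\<omega>. C * exp (real n * \<bar>X \<omega>\<bar> + k * \<bar>Y \<omega>\<bar>))"
        by (intro integrable_mult_right integrable_exp_abs)
      show "AE \<omega> in M. norm (\<bar>hermite n (X \<omega>)\<bar> * exp (k * \<bar>Y \<omega>\<bar>)) \<le> norm (C * exp (real n * \<bar>X \<omega>\<bar> + k * \<bar>Y \<omega>\<bar>))"
      proof (rule AE_I2)
        fix \<omega>
        have "\<bar>hermite n (X \<omega>)\<bar> * exp (k * \<bar>Y \<omega>\<bar>) \<le> (C * exp (real n * \<bar>X \<omega>\<bar>)) * exp (k * \<bar>Y \<omega>\<bar>)"
          by (rule mult_right_mono[OF C(2)]) simp
        then show "norm (\<bar>hermite n (X \<omega>)\<bar> * exp (k * \<bar>Y \<omega>\<bar>)) \<le> norm (C * exp (real n * \<bar>X \<omega>\<bar> + k * \<bar>Y \<omega>\<bar>))"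
          using C(1) by (simp add: abs_mult exp_add)
      qed
    qed measurable
  qed
  have "(\<lambda>\<omega>. hermite n (X \<omega>)) \<in> borel_measurable M" by measurable
  from higher_deriv_integral_exp[OF Y_meas this int, of n] higher_deriv_monomial[of n "\<rho> ^ n"]
  have "(\<lambda>s. \<integral>\<omega>. hermite n (X \<omega>) * (hermite n (Y \<omega> - s) * exp (s * Y \<omega> - s^2 / 2)) \<partial>M) = (\<lambda>s. \<rho> ^ n * fact n)"
    by (simp add: expectation_hermite_exp)
  from fun_cong[OF this, of 0] show ?thesis by simp
qed

end


section \<open>Second moment of a chaos integral\<close>

lemma integrable_mult_of_square:
  fixes f g :: "'a \<Rightarrow> real"
  assumes [measurable]: "f \<in> borel_measurable M" "g \<in> borel_measurable M"
    and "integrable M (\<lambda>x. (f x)^2)" "integrable M (\<lambda>x. (g x)^2)"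
  shows "integrable M (\<lambda>x. f x * g x)"
proof (rule Bochner_Integration.integrable_bound)
  show "integrable M (\<lambda>x. (f x)^2 + (g x)^2)" using assms by simp
  show "AE x in M. norm (f x * g x) \<le> norm ((f x)^2 + (g x)^2)"
  proof (rule AE_I2)
    fix x
    have "2 * (\<bar>f x\<bar> * \<bar>g x\<bar>) \<le> (f x)^2 + (g x)^2"
      using sum_squares_bound[of "\<bar>f x\<bar>" "\<bar>g x\<bar>"] by simp
    moreover have "0 \<le> \<bar>f x\<bar> * \<bar>g x\<bar>" by simp
    ultimately show "norm (f x * g x) \<le> norm ((f x)^2 + (g x)^2)"
      unfolding real_norm_def abs_mult by linarith
  qed
qed measurable

lemma isonormal_measurable: "isonormal M W \<Longrightarrow> l2fun h \<Longrightarrow> W h \<in> borel_measurable M"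
  unfolding isonormal_def by blast

text \<open>The two-element subfamily of the isonormal process; unit norms make both variables
  standard.\<close>

lemma isonormal_gaussian_pair:
  assumes M: "prob_space M" and W: "isonormal M W"
    and h: "l2fun h" "ip h h = 1" and g: "l2fun g" "ip g g = 1"
  shows "gaussian_pair M (W h) (W g) (ip h g)"
proof -
  interpret prob_space M by (rule M)
  have sym: "ip g h = ip h g" by (simp add: ip_def mult.commute)
  have sum2: "(\<Sum>i<2. f i) = f 0 + f 1" for f :: "nat \<Rightarrow> real"
    by (simp add: numeral_2_eq_2)
  show ?thesis
  proof
    show "W h \<in> borel_measurable M" "W g \<in> borel_measurable M"
      using isonormal_measurable[OF W] h g by auto
    fix s t :: real
    define hs :: "nat \<Rightarrow> real \<Rightarrow> real" where "hs i = (if i = 0 then h else g)" for i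
    define r :: "nat \<Rightarrow> real" where "r i = (if i = 0 then s else t)" for i
    have [simp]: "hs 0 = h" "hs (Suc 0) = g" "r 0 = s" "r (Suc 0) = t" by (simp_all add: hs_def r_def)
    have "\<forall>i<2. l2fun (hs i)" using h g by (simp add: hs_def)
    with W have "(\<integral>\<omega>. exp (\<Sum>i<2. r i * W (hs i) \<omega>) \<partial>M)
      = exp ((\<Sum>i<2. \<Sum>j<2. r i * r j * ip (hs i) (hs j)) / 2)"
      unfolding isonormal_def by blast
    moreover have "(\<Sum>i<2. r i * W (hs i) \<omega>) = s * W h \<omega> + t * W g \<omega>" for \<omega>
      unfolding sum2 by simp
    moreover have "(\<Sum>i<2. \<Sum>j<2. r i * r j * ip (hs i) (hs j)) = s^2 + 2 * s * t * ip h g + t^2"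
      unfolding sum2 using h(2) g(2) by (simp add: sym power2_eq_square)
    ultimately show "(\<integral>\<omega>. exp (s * W h \<omega> + t * W g \<omega>) \<partial>M) = exp ((s^2 + 2 * s * t * ip h g + t^2) / 2)"
      by (simp only:)
  qed
qed

text \<open>On product measure the integrand splits into one factor \<open>h g\<close> per
  coordinate, so the inner product of tensor powers is a power of \<open>ip h g\<close>, matching
  the Hermite moment up to \<open>fact q\<close>.\<close>

lemma
  assumes "l2fun h" "l2fun g"
  shows integrable_tensor_mult: "integrable (PiM {..<q} (\<lambda>_. lborel)) (\<lambda>\<psi>. (\<Prod>j<q. h (\<psi> j)) * (\<Prod>j<q. g (\<psi> j)))"
    and integral_tensor_mult: "(\<integral>\<psi>. (\<Prod>j<q. h (\<psi> j)) * (\<Prod>j<q. g (\<psi> j)) \<partial>(PiM {..<q} (\<lambda>_. lborel))) = ip h g ^ q"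
proof -
  interpret product_sigma_finite "\<lambda>_::nat. lborel :: real measure" by standard
  have int: "integrable lborel (\<lambda>x. h x * g x)"
    using assms by (intro integrable_mult_of_square) (auto simp: l2fun_def)
  show "integrable (PiM {..<q} (\<lambda>_. lborel)) (\<lambda>\<psi>. (\<Prod>j<q. h (\<psi> j)) * (\<Prod>j<q. g (\<psi> j)))"
    unfolding prod.distrib[symmetric] using int by (intro product_integrable_prod[where f = "\<lambda>_ x. h x * g x"]) auto
  show "(\<integral>\<psi>. (\<Prod>j<q. h (\<psi> j)) * (\<Prod>j<q. g (\<psi> j)) \<partial>(PiM {..<q} (\<lambda>_. lborel))) = ip h g ^ q"
    unfolding prod.distrib[symmetric]
    using product_integral_prod[of "{..<q}" "\<lambda>_ x. h x * g x"] int by (simp add: ip_def)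
qed

lemma integral_double_sum:
  fixes a :: "nat \<Rightarrow> nat \<Rightarrow> real" and f :: "nat \<Rightarrow> nat \<Rightarrow> 'a \<Rightarrow> real"
  assumes int: "\<And>i j. i < n \<Longrightarrow> j < n \<Longrightarrow> integrable M (f i j)"
  shows "(\<integral>x. (\<Sum>i<n. \<Sum>j<n. a i j * f i j x) \<partial>M) = (\<Sum>i<n. \<Sum>j<n. a i j * (\<integral>x. f i j x \<partial>M))"
proof -
  have "(\<integral>x. (\<Sum>i<n. \<Sum>j<n. a i j * f i j x) \<partial>M) = (\<Sum>i<n. \<integral>x. (\<Sum>j<n. a i j * f i j x) \<partial>M)"
    by (rule Bochner_Integration.integral_sum) (auto intro!: Bochner_Integration.integrable_sum integrable_mult_right int)
  also have "\<dots> = (\<Sum>i<n. \<Sum>j<n. \<integral>x. a i j * f i j x \<partial>M)"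
    by (intro sum.cong refl Bochner_Integration.integral_sum) (auto intro!: integrable_mult_right int)
  finally show ?thesis by simp
qed

text \<open>With \<open>S = \<Sum> c\<^sub>i He\<^sub>q(W h\<^sub>i)\<close> close to \<open>Y\<close> and \<open>F = \<Sum> c\<^sub>i h\<^sub>i\<^sup>\<otimes>\<^sup>q\<close> one has
  \<open>E[Y S] = q! <f, F>\<close> and \<open>E[S\<^sup>2] = q! |F|\<^sup>2\<close>, so that
  \<open>E[Y\<^sup>2] = E[(Y - S)\<^sup>2] + 2 E[Y S] - E[S\<^sup>2] \<le> E[(Y - S)\<^sup>2] + q! |f|\<^sup>2\<close>.\<close>

lemma chaos_integral_second_moment:
  assumes M: "prob_space M" and W: "isonormal M W" and Y: "chaos_integral M W q f Y"
    and f: "f \<in> borel_measurable (PiM {..<q} (\<lambda>_. lborel))"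
      "integrable (PiM {..<q} (\<lambda>_. lborel)) (\<lambda>\<psi>. (f \<psi>)^2)"
  shows "(\<integral>\<omega>. (Y \<omega>)^2 \<partial>M) \<le> fact q * (\<integral>\<psi>. (f \<psi>)^2 \<partial>(PiM {..<q} (\<lambda>_. lborel)))"
proof (rule field_le_epsilon)
  fix \<delta> :: real assume "\<delta> > 0"
  define N where "N = PiM {..<q} (\<lambda>_::nat. lborel :: real measure)"
  obtain n :: nat and c :: "nat \<Rightarrow> real" and hs :: "nat \<Rightarrow> real \<Rightarrow> real"
    where hs: "\<And>i. i < n \<Longrightarrow> l2fun (hs i)" "\<And>i. i < n \<Longrightarrow> ip (hs i) (hs i) = 1"
      and close: "(\<integral>\<omega>. (Y \<omega> - (\<Sum>i<n. c i * hermite q (W (hs i) \<omega>)))^2 \<partial>M) < \<delta>"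
  proof -
    have "\<exists>(n::nat) (c :: nat \<Rightarrow> real) (hs :: nat \<Rightarrow> real \<Rightarrow> real).
        (\<forall>i<n. l2fun (hs i) \<and> ip (hs i) (hs i) = 1) \<and>
        (\<integral>\<omega>. (Y \<omega> - (\<Sum>i<n. c i * hermite q (W (hs i) \<omega>)))^2 \<partial>M) < \<delta>"
      using Y[unfolded chaos_integral_def, THEN conjunct2, THEN conjunct2, THEN conjunct2, rule_format, OF \<open>\<delta> > 0\<close>] .
    then show thesis using that by blast
  qed
  have Ym [measurable]: "Y \<in> borel_measurable M" and Y2: "integrable M (\<lambda>\<omega>. (Y \<omega>)^2)"
    and YH: "\<And>h. l2fun h \<Longrightarrow> ip h h = 1 \<Longrightarrow>
        (\<integral>\<omega>. Y \<omega> * hermite q (W h \<omega>) \<partial>M) = fact q * (\<integral>\<psi>. f \<psi> * (\<Prod>j<q. h (\<psi> j)) \<partial>N)"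
    using Y unfolding chaos_integral_def N_def by blast+
  define S where "S \<omega> = (\<Sum>i<n. c i * hermite q (W (hs i) \<omega>))" for \<omega>
  define F where "F \<psi> = (\<Sum>i<n. c i * (\<Prod>j<q. hs i (\<psi> j)))" for \<psi> :: "nat \<Rightarrow> real"
  have Wm: "W (hs i) \<in> borel_measurable M" if "i < n" for i
    using isonormal_measurable[OF W hs(1)[OF that]] .
  have Hm: "(\<lambda>\<omega>. hermite q (W (hs i) \<omega>)) \<in> borel_measurable M" if "i < n" for i
    using measurable_compose[OF Wm[OF that] borel_measurable_hermite] by simp
  have HH: "integrable M (\<lambda>\<omega>. hermite q (W (hs i) \<omega>) * hermite q (W (hs j) \<omega>))"
    "(\<integral>\<omega>. hermite q (W (hs i) \<omega>) * hermite q (W (hs j) \<omega>) \<partial>M) = fact q * ip (hs i) (hs j) ^ q"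
    if "i < n" "j < n" for i j
  proof -
    interpret gaussian_pair M "W (hs i)" "W (hs j)" "ip (hs i) (hs j)"
      using that hs by (intro isonormal_gaussian_pair M W)
    show "integrable M (\<lambda>\<omega>. hermite q (W (hs i) \<omega>) * hermite q (W (hs j) \<omega>))"
      "(\<integral>\<omega>. hermite q (W (hs i) \<omega>) * hermite q (W (hs j) \<omega>) \<partial>M) = fact q * ip (hs i) (hs j) ^ q"
      by (rule integrable_hermite_mult expectation_hermite_mult)+
  qed
  have S2_eq: "(S \<omega>)^2 = (\<Sum>i<n. \<Sum>j<n. c i * c j * (hermite q (W (hs i) \<omega>) * hermite q (W (hs j) \<omega>)))" for \<omega>
    unfolding S_def power2_eq_square sum_product by (simp add: mult_ac)
  have F2_eq: "(F \<psi>)^2 = (\<Sum>i<n. \<Sum>j<n. c i * c j * ((\<Prod>k<q. hs i (\<psi> k)) * (\<Prod>k<q. hs j (\<psi> k))))" for \<psi>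
    unfolding F_def power2_eq_square sum_product by (simp add: mult_ac)
  have S2: "integrable M (\<lambda>\<omega>. (S \<omega>)^2)"
    unfolding S2_eq by (intro Bochner_Integration.integrable_sum integrable_mult_right HH) auto
  have F2: "integrable N (\<lambda>\<psi>. (F \<psi>)^2)"
    unfolding F2_eq N_def
    by (intro Bochner_Integration.integrable_sum integrable_mult_right integrable_tensor_mult) (auto intro: hs)
  have "(\<integral>\<omega>. (S \<omega>)^2 \<partial>M) = (\<Sum>i<n. \<Sum>j<n. c i * c j * (fact q * ip (hs i) (hs j) ^ q))"
    unfolding S2_eq by (subst integral_double_sum) (auto simp: HH)
  also have "\<dots> = fact q * (\<Sum>i<n. \<Sum>j<n. c i * c j * (ip (hs i) (hs j) ^ q))"
    by (simp add: sum_distrib_left mult_ac)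
  also have "(\<Sum>i<n. \<Sum>j<n. c i * c j * (ip (hs i) (hs j) ^ q)) = (\<integral>\<psi>. (F \<psi>)^2 \<partial>N)"
    unfolding F2_eq N_def
    by (subst integral_double_sum) (auto simp: integrable_tensor_mult integral_tensor_mult hs(1))
  finally have ES: "(\<integral>\<omega>. (S \<omega>)^2 \<partial>M) = fact q * (\<integral>\<psi>. (F \<psi>)^2 \<partial>N)" .
  have tm: "(\<lambda>\<psi>. \<Prod>j<q. hs i (\<psi> j)) \<in> borel_measurable N" if "i < n" for i
  proof -
    have [measurable]: "hs i \<in> borel_measurable borel" using hs(1)[OF that] by (simp add: l2fun_def)
    show ?thesis unfolding N_def by measurable
  qed
  have fm: "f \<in> borel_measurable N" and f2: "integrable N (\<lambda>\<psi>. (f \<psi>)^2)"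
    using f by (simp_all add: N_def)
  have Fm: "F \<in> borel_measurable N"
    unfolding F_def by (intro borel_measurable_sum borel_measurable_times tm) auto
  have Sm: "S \<in> borel_measurable M"
    unfolding S_def by (intro borel_measurable_sum borel_measurable_times Hm) auto
  have YHi: "integrable M (\<lambda>\<omega>. Y \<omega> * hermite q (W (hs i) \<omega>))" if "i < n" for i
    using HH(1)[OF that that] by (intro integrable_mult_of_square Ym Y2 Hm that) (simp add: power2_eq_square)
  have fti: "integrable N (\<lambda>\<psi>. f \<psi> * (\<Prod>j<q. hs i (\<psi> j)))" if "i < n" for i
    using integrable_tensor_mult[OF hs(1)[OF that] hs(1)[OF that], of q]
    by (intro integrable_mult_of_square fm f2 tm that) (simp add: power2_eq_square N_def)
  have YS: "integrable M (\<lambda>\<omega>. Y \<omega> * S \<omega>)" by (intro integrable_mult_of_square Ym Y2 Sm S2)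
  have fF: "integrable N (\<lambda>\<psi>. f \<psi> * F \<psi>)" by (intro integrable_mult_of_square fm f2 Fm F2)
  have "(\<integral>\<omega>. Y \<omega> * S \<omega> \<partial>M) = (\<integral>\<omega>. (\<Sum>i<n. c i * (Y \<omega> * hermite q (W (hs i) \<omega>))) \<partial>M)"
    by (simp add: S_def sum_distrib_left mult_ac)
  also have "\<dots> = (\<Sum>i<n. c i * (fact q * (\<integral>\<psi>. f \<psi> * (\<Prod>j<q. hs i (\<psi> j)) \<partial>N)))"
    by (subst Bochner_Integration.integral_sum) (auto simp: YHi YH hs)
  also have "\<dots> = fact q * (\<integral>\<psi>. (\<Sum>i<n. c i * (f \<psi> * (\<Prod>j<q. hs i (\<psi> j)))) \<partial>N)"
    by (subst Bochner_Integration.integral_sum) (auto simp: fti sum_distrib_left mult_ac)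
  also have "\<dots> = fact q * (\<integral>\<psi>. f \<psi> * F \<psi> \<partial>N)"
    by (simp add: F_def sum_distrib_left mult_ac)
  finally have EYS: "(\<integral>\<omega>. Y \<omega> * S \<omega> \<partial>M) = fact q * (\<integral>\<psi>. f \<psi> * F \<psi> \<partial>N)" .
  have "(\<integral>\<omega>. (Y \<omega> - S \<omega>)^2 \<partial>M) = (\<integral>\<omega>. (Y \<omega>)^2 + (S \<omega>)^2 - 2 * (Y \<omega> * S \<omega>) \<partial>M)"
    by (simp add: power2_diff mult.assoc)
  also have "\<dots> = (\<integral>\<omega>. (Y \<omega>)^2 \<partial>M) + (\<integral>\<omega>. (S \<omega>)^2 \<partial>M) - 2 * (\<integral>\<omega>. Y \<omega> * S \<omega> \<partial>M)"
    using Y2 S2 YS by simp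
  finally have 1: "(\<integral>\<omega>. (Y \<omega>)^2 \<partial>M) + (\<integral>\<omega>. (S \<omega>)^2 \<partial>M) - 2 * (\<integral>\<omega>. Y \<omega> * S \<omega> \<partial>M) < \<delta>"
    using close by (simp add: S_def)
  \<comment> \<open>Expanding the square gives \<open>2 <f, F> - |F|^2 \<le> |f|^2\<close>. The
    symmetric function \<open>F\<close> need not be close to \<open>f\<close>, which is why an
    inequality is obtained here rather than an isometry.\<close>
  have "0 \<le> (\<integral>\<psi>. (f \<psi> - F \<psi>)^2 \<partial>N)" by simp
  also have "\<dots> = (\<integral>\<psi>. (f \<psi>)^2 + (F \<psi>)^2 - 2 * (f \<psi> * F \<psi>) \<partial>N)"
    by (simp add: power2_diff mult.assoc)
  also have "\<dots> = (\<integral>\<psi>. (f \<psi>)^2 \<partial>N) + (\<integral>\<psi>. (F \<psi>)^2 \<partial>N) - 2 * (\<integral>\<psi>. f \<psi> * F \<psi> \<partial>N)"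
    using f2 F2 fF by simp
  finally have "0 \<le> fact q * ((\<integral>\<psi>. (f \<psi>)^2 \<partial>N) + (\<integral>\<psi>. (F \<psi>)^2 \<partial>N) - 2 * (\<integral>\<psi>. f \<psi> * F \<psi> \<partial>N))"
    by simp
  then have "2 * (\<integral>\<omega>. Y \<omega> * S \<omega> \<partial>M) \<le> fact q * (\<integral>\<psi>. (f \<psi>)^2 \<partial>N) + (\<integral>\<omega>. (S \<omega>)^2 \<partial>M)"
    unfolding ES EYS by (simp add: algebra_simps)
  with 1 show "(\<integral>\<omega>. (Y \<omega>)^2 \<partial>M) \<le> fact q * (\<integral>\<psi>. (f \<psi>)^2 \<partial>(PiM {..<q} (\<lambda>_. lborel))) + \<delta>"
    by (simp add: N_def)
qed


section \<open>The Hermite kernel\<close>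

lemma borel_measurable_ppow [measurable]: "(\<lambda>x. ppow x \<alpha>) \<in> borel_measurable borel"
  unfolding ppow_def by measurable

lemma ppow_nonneg [simp]: "0 \<le> ppow x \<alpha>"
  by (simp add: ppow_def)

lemma nn_integral_powr_left:
  assumes "a > -1" "l \<ge> 0"
  shows "(\<integral>\<^sup>+x. ennreal (indicator {0..l} x * x powr a) \<partial>lborel) = ennreal (l powr (a + 1) / (a + 1))"
  by (rule nn_integral_has_integral_lebesgue[OF _ has_integral_powr_from_0[OF assms]]) auto

lemma nn_integral_powr_right:
  assumes "a < -1" "l > 0"
  shows "(\<integral>\<^sup>+x. ennreal (indicator {l..} x * x powr a) \<partial>lborel) = ennreal (- (l powr (a + 1)) / (a + 1))"
  by (rule nn_integral_has_integral_lebesgue[OF _ has_integral_powr_to_inf[OF assms]]) auto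

text \<open>After reflection the integrand is \<open>x^\<alpha> (d + x)^\<alpha>\<close> on
  \<open>x > 0\<close>, with \<open>d = v - u\<close>. For \<open>x \<le> d\<close> the second
  factor is at most \<open>d^\<alpha>\<close>, and \<open>x^\<alpha>\<close> is integrable at 0
  because \<open>\<alpha> > -1\<close>. For \<open>x > d\<close> both factors are at most
  \<open>x^\<alpha>\<close>, and \<open>x^(2\<alpha>)\<close> is integrable at infinity because
  \<open>2\<alpha> < -1\<close>. The two ranges contribute the two summands of the constant; the
  exact constant would be \<open>Beta (\<alpha> + 1) (-2\<alpha> - 1)\<close>.\<close>

lemma nn_integral_ppow_mult_le_aux:
  assumes \<alpha>: "-1 < \<alpha>" "\<alpha> < -1/2" and uv: "u < v"
  shows "(\<integral>\<^sup>+x. ennreal (ppow (u - x) \<alpha> * ppow (v - x) \<alpha>) \<partial>lborel)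
    \<le> ennreal ((1 / (\<alpha> + 1) - 1 / (2 * \<alpha> + 1)) * (v - u) powr (2 * \<alpha> + 1))"
proof -
  define d where "d = v - u"
  have d: "d > 0" using uv by (simp add: d_def)
  have "(\<integral>\<^sup>+x. ennreal (ppow (u - x) \<alpha> * ppow (v - x) \<alpha>) \<partial>lborel)
      = (\<integral>\<^sup>+x. ennreal (ppow x \<alpha> * ppow (d + x) \<alpha>) \<partial>lborel)"
    by (subst nn_integral_real_affine[where c = "-1" and t = u]) (auto simp: d_def algebra_simps)
  also have "\<dots> \<le> (\<integral>\<^sup>+x. ennreal (d powr \<alpha>) * ennreal (indicator {0..d} x * x powr \<alpha>)
      + ennreal (indicator {d..} x * x powr (2 * \<alpha>)) \<partial>lborel)"
  proof (rule nn_integral_mono)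
    fix x
    show "ennreal (ppow x \<alpha> * ppow (d + x) \<alpha>) \<le> ennreal (d powr \<alpha>) * ennreal (indicator {0..d} x * x powr \<alpha>)
        + ennreal (indicator {d..} x * x powr (2 * \<alpha>))"
    proof -
      consider "x \<le> 0" | "0 < x" "x \<le> d" | "d < x" by linarith
      then have "ppow x \<alpha> * ppow (d + x) \<alpha> \<le> d powr \<alpha> * (indicator {0..d} x * x powr \<alpha>)
          + indicator {d..} x * x powr (2 * \<alpha>)"
      proof cases
        case 1
        then show ?thesis by (simp add: ppow_def)
      next
        case 2
        have "(d + x) powr \<alpha> \<le> d powr \<alpha>" by (rule powr_mono2') (use 2 d \<alpha> in auto)
        then have "x powr \<alpha> * (d + x) powr \<alpha> \<le> d powr \<alpha> * x powr \<alpha>"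
          using mult_right_mono[of "(d + x) powr \<alpha>" "d powr \<alpha>" "x powr \<alpha>"] by (simp add: mult.commute)
        moreover have "0 \<le> indicat_real {d..} x * x powr (2 * \<alpha>)" by simp
        ultimately have "x powr \<alpha> * (d + x) powr \<alpha> \<le> d powr \<alpha> * x powr \<alpha> + indicat_real {d..} x * x powr (2 * \<alpha>)"
          by linarith
        then show ?thesis using 2 d by (simp add: ppow_def)
      next
        case 3
        have "(d + x) powr \<alpha> \<le> x powr \<alpha>" by (rule powr_mono2') (use 3 d \<alpha> in auto)
        then have "x powr \<alpha> * (d + x) powr \<alpha> \<le> x powr \<alpha> * x powr \<alpha>"
          by (simp add: mult_left_mono)
        also have "\<dots> = x powr (2 * \<alpha>)" by (simp add: powr_add[symmetric])
        finally show ?thesis using 3 d by (simp add: ppow_def)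
      qed
      then show ?thesis
        by (simp add: ennreal_mult[symmetric] ennreal_plus[symmetric] ennreal_leI del: ennreal_plus)
    qed
  qed
  also have "\<dots> = ennreal (d powr \<alpha>) * ennreal (d powr (\<alpha> + 1) / (\<alpha> + 1)) + ennreal (- (d powr (2 * \<alpha> + 1)) / (2 * \<alpha> + 1))"
    using \<alpha> d by (simp add: nn_integral_add nn_integral_cmult nn_integral_powr_left nn_integral_powr_right)
  also have "\<dots> = ennreal (d powr \<alpha> * (d powr (\<alpha> + 1) / (\<alpha> + 1)) + - (d powr (2 * \<alpha> + 1)) / (2 * \<alpha> + 1))"
  proof -
    have "0 \<le> - (d powr (2 * \<alpha> + 1)) / (2 * \<alpha> + 1)" using \<alpha> by (intro divide_nonpos_neg) auto
    moreover have "0 \<le> d powr \<alpha> * (d powr (\<alpha> + 1) / (\<alpha> + 1))" using \<alpha> by simp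
    ultimately have "ennreal (d powr \<alpha> * (d powr (\<alpha> + 1) / (\<alpha> + 1)) + - (d powr (2 * \<alpha> + 1)) / (2 * \<alpha> + 1))
        = ennreal (d powr \<alpha> * (d powr (\<alpha> + 1) / (\<alpha> + 1))) + ennreal (- (d powr (2 * \<alpha> + 1)) / (2 * \<alpha> + 1))"
      by (intro ennreal_plus)
    moreover have "ennreal (d powr \<alpha> * (d powr (\<alpha> + 1) / (\<alpha> + 1))) = ennreal (d powr \<alpha>) * ennreal (d powr (\<alpha> + 1) / (\<alpha> + 1))"
      using \<alpha> by (intro ennreal_mult) auto
    ultimately show ?thesis by (elim ssubst) (rule refl)
  qed
  also have "d powr \<alpha> * (d powr (\<alpha> + 1) / (\<alpha> + 1)) = d powr (2 * \<alpha> + 1) / (\<alpha> + 1)"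
    by (simp add: powr_add[symmetric])
  finally show ?thesis by (simp add: d_def algebra_simps)
qed

lemma nn_integral_ppow_mult_le:
  assumes \<alpha>: "-1 < \<alpha>" "\<alpha> < -1/2" and uv: "u \<noteq> v"
  shows "(\<integral>\<^sup>+x. ennreal (ppow (u - x) \<alpha> * ppow (v - x) \<alpha>) \<partial>lborel)
    \<le> ennreal ((1 / (\<alpha> + 1) - 1 / (2 * \<alpha> + 1)) * \<bar>u - v\<bar> powr (2 * \<alpha> + 1))"
proof (cases "u < v")
  case True
  with nn_integral_ppow_mult_le_aux[OF \<alpha> True] show ?thesis by (simp add: abs_if)
next
  case False
  with uv have "v < u" by simp
  with nn_integral_ppow_mult_le_aux[OF \<alpha> this] show ?thesis by (simp add: abs_if mult.commute)
qed

text \<open>The first two bounds place the kernel exponent in the range where the overlap integral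
  converges, using \<open>H - 1 > -1/2 \<ge> -q/2\<close>. The identity says that \<open>q\<close>
  overlap factors multiply to exactly the exponent \<open>2 H - 2\<close> of the covariance.\<close>

lemma H0_exponent:
  assumes "q \<ge> 1" "1/2 < H" "H < 1"
  shows "-1 < H0 q H - 3/2" "H0 q H - 3/2 < -1/2" "real q * (2 * (H0 q H - 3/2) + 1) = 2 * H - 2"
proof -
  have "-1/2 < (H - 1) / real q"
  proof -
    have "- real q / 2 \<le> -1/2" using assms by simp
    also have "\<dots> < H - 1" using assms by simp
    finally show ?thesis using assms by (simp add: field_simps)
  qed
  then show "-1 < H0 q H - 3/2" by (simp add: H0_def)
  have "(H - 1) / real q < 0" using assms by (simp add: divide_neg_pos)
  then show "H0 q H - 3/2 < -1/2" by (simp add: H0_def)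
  show "real q * (2 * (H0 q H - 3/2) + 1) = 2 * H - 2"
    using assms by (simp add: H0_def field_simps)
qed

text \<open>The constant of the overlap estimate at exponent \<open>H0 q H - 3/2\<close>: an upper
  bound for the Beta value that occurs in \<open>cqH\<close>.\<close>

definition ppow_const :: "nat \<Rightarrow> real \<Rightarrow> real" where
  "ppow_const q H = 1 / (H0 q H - 3/2 + 1) - 1 / (2 * (H0 q H - 3/2) + 1)"

lemma ppow_const_nonneg:
  assumes "q \<ge> 1" "1/2 < H" "H < 1"
  shows "ppow_const q H \<ge> 0"
proof -
  have "1 / (H0 q H - 3/2 + 1) \<ge> 0" "1 / (2 * (H0 q H - 3/2) + 1) \<le> 0"
    using H0_exponent(1,2)[OF assms] by (auto simp: divide_nonneg_neg)
  then show ?thesis unfolding ppow_const_def by linarith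
qed

text \<open>The integral over the product space is the q-th power of a single overlap integral. The
  diagonal has to be excluded: there the left side diverges, while \<open>0 powr (2 * H - 2)\<close>
  is 0 by convention.\<close>

lemma nn_integral_prod_ppow_le:
  assumes q: "q \<ge> 1" "1/2 < H" "H < 1" and uv: "u \<noteq> v"
  defines "\<alpha> \<equiv> H0 q H - 3/2"
  shows "(\<integral>\<^sup>+\<psi>. ennreal ((\<Prod>j<q. ppow (u - \<psi> j) \<alpha>) * (\<Prod>j<q. ppow (v - \<psi> j) \<alpha>)) \<partial>(PiM {..<q} (\<lambda>_. lborel)))
    \<le> ennreal (ppow_const q H ^ q * \<bar>u - v\<bar> powr (2 * H - 2))"
proof -
  interpret product_sigma_finite "\<lambda>_::nat. lborel :: real measure" by standard
  have "(\<integral>\<^sup>+\<psi>. ennreal ((\<Prod>j<q. ppow (u - \<psi> j) \<alpha>) * (\<Prod>j<q. ppow (v - \<psi> j) \<alpha>)) \<partial>(PiM {..<q} (\<lambda>_. lborel)))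
      = (\<integral>\<^sup>+\<psi>. (\<Prod>j<q. (\<lambda>_ x. ennreal (ppow (u - x) \<alpha> * ppow (v - x) \<alpha>)) j (\<psi> j)) \<partial>(PiM {..<q} (\<lambda>_. lborel)))"
    by (simp add: prod_ennreal prod.distrib)
  also have "\<dots> = (\<integral>\<^sup>+x. ennreal (ppow (u - x) \<alpha> * ppow (v - x) \<alpha>) \<partial>lborel) ^ q"
    by (subst product_nn_integral_prod) auto
  also have "\<dots> \<le> ennreal (ppow_const q H * \<bar>u - v\<bar> powr (2 * \<alpha> + 1)) ^ q"
    unfolding ppow_const_def \<alpha>_def
    by (intro power_mono nn_integral_ppow_mult_le uv H0_exponent q) auto
  also have "\<dots> = ennreal ((ppow_const q H * \<bar>u - v\<bar> powr (2 * \<alpha> + 1)) ^ q)"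
    using ppow_const_nonneg[OF q] by (intro ennreal_power) auto
  also have "(\<bar>u - v\<bar> powr (2 * \<alpha> + 1)) ^ q = \<bar>u - v\<bar> powr (2 * H - 2)"
    unfolding \<alpha>_def H0_exponent(3)[OF q, symmetric] by (rule powr_power) (use uv in auto)
  then have "(ppow_const q H * \<bar>u - v\<bar> powr (2 * \<alpha> + 1)) ^ q = ppow_const q H ^ q * \<bar>u - v\<bar> powr (2 * H - 2)"
    by (simp add: power_mult_distrib)
  finally show ?thesis .
qed

section \<open>The L2 norm of the Hermite kernel\<close>

lemma borel_measurable_hermite_kernel:
  assumes [measurable]: "f \<in> borel_measurable borel"
  shows "hermite_kernel q H f \<in> borel_measurable (PiM {..<q} (\<lambda>_. lborel))"
  unfolding hermite_kernel_def[abs_def] by measurable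

lemma nn_integral_square:
  assumes [measurable]: "g \<in> borel_measurable M"
  shows "(\<integral>\<^sup>+x. g x \<partial>M)^2 = (\<integral>\<^sup>+x. \<integral>\<^sup>+y. g x * g y \<partial>M \<partial>M)"
  by (simp add: nn_integral_cmult nn_integral_multc power2_eq_square)

text \<open>With absolute values inside, the square of the kernel becomes a double integral over
  \<open>u\<close> and \<open>v\<close>. All integrands are then nonnegative, so Tonelli moves the
  integration over \<psi> to the inside, where the product overlap estimate applies.\<close>

lemma nn_integral_hermite_kernel_square:
  assumes q: "q \<ge> 1" "1/2 < H" "H < 1" and f [measurable]: "f \<in> borel_measurable borel"
  shows "(\<integral>\<^sup>+\<psi>. ennreal ((hermite_kernel q H f \<psi>)^2) \<partial>(PiM {..<q} (\<lambda>_. lborel)))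
    \<le> ennreal (ppow_const q H ^ q) *
      (\<integral>\<^sup>+u. \<integral>\<^sup>+v. ennreal (\<bar>f u * f v\<bar> * \<bar>u - v\<bar> powr (2 * H - 2)) \<partial>lborel \<partial>lborel)"
proof -
  interpret product_sigma_finite "\<lambda>_::nat. lborel :: real measure" by standard
  define N where "N = PiM {..<q} (\<lambda>_::nat. lborel :: real measure)"
  interpret N: sigma_finite_measure N unfolding N_def by (rule sigma_finite) simp
  interpret P: pair_sigma_finite N "lborel :: real measure" by standard
  define a where "a \<psi> u = (\<Prod>j<q. ppow (u - \<psi> j) (H0 q H - 3/2))" for \<psi> :: "nat \<Rightarrow> real" and u
  have a0: "0 \<le> a \<psi> u" for \<psi> u unfolding a_def by (intro prod_nonneg) auto
  \<comment> \<open>Stated for arbitrary measurable arguments so that it covers every iterated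
    integrand below.\<close>
  have am [measurable]: "(\<lambda>x. a (A x) (B x)) \<in> borel_measurable K"
    if [measurable]: "A \<in> measurable K N" "B \<in> borel_measurable K" for K :: "'k measure" and A B
  proof -
    have [measurable]: "(\<lambda>x. A x j) \<in> borel_measurable K" if "j < q" for j
      using measurable_compose[OF \<open>A \<in> measurable K N\<close>[unfolded N_def] measurable_component_singleton[of j "{..<q}"]] that
      by simp
    show ?thesis unfolding a_def by measurable
  qed
  let ?F = "\<lambda>\<psi> u v. ennreal (\<bar>f u\<bar> * a \<psi> u) * ennreal (\<bar>f v\<bar> * a \<psi> v)"
  have "ennreal ((hermite_kernel q H f \<psi>)^2) \<le> (\<integral>\<^sup>+u. \<integral>\<^sup>+v. ?F \<psi> u v \<partial>lborel \<partial>lborel)" if "\<psi> \<in> space N" for \<psi>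
  proof -
    have [measurable]: "(\<lambda>u. a \<psi> u) \<in> borel_measurable borel"
      by (rule am) (use that in auto)
    have k: "hermite_kernel q H f \<psi> = (\<integral>u. f u * a \<psi> u \<partial>lborel)"
      by (simp add: hermite_kernel_def a_def)
    have "ennreal \<bar>hermite_kernel q H f \<psi>\<bar> \<le> (\<integral>\<^sup>+u. ennreal (\<bar>f u\<bar> * a \<psi> u) \<partial>lborel)"
    proof (cases "integrable lborel (\<lambda>u. f u * a \<psi> u)")
      case True
      from integral_norm_bound_ennreal[OF True] show ?thesis unfolding k by (simp add: abs_mult a0)
    next
      \<comment> \<open>At a \<psi> where the integrand is not integrable, the kernel is 0 by the
        convention for Bochner integrals, so the bound persists.\<close>
      case False
      then show ?thesis unfolding k by (simp add: not_integrable_integral_eq)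
    qed
    then have "(ennreal \<bar>hermite_kernel q H f \<psi>\<bar>)^2 \<le> (\<integral>\<^sup>+u. ennreal (\<bar>f u\<bar> * a \<psi> u) \<partial>lborel)^2"
      by (rule power_mono) simp
    also have "(ennreal \<bar>hermite_kernel q H f \<psi>\<bar>)^2 = ennreal ((hermite_kernel q H f \<psi>)^2)"
      by (simp add: ennreal_power)
    also have "(\<integral>\<^sup>+u. ennreal (\<bar>f u\<bar> * a \<psi> u) \<partial>lborel)^2 = (\<integral>\<^sup>+u. \<integral>\<^sup>+v. ?F \<psi> u v \<partial>lborel \<partial>lborel)"
      by (rule nn_integral_square) measurable
    finally show ?thesis .
  qed
  then have "(\<integral>\<^sup>+\<psi>. ennreal ((hermite_kernel q H f \<psi>)^2) \<partial>N) \<le> (\<integral>\<^sup>+\<psi>. \<integral>\<^sup>+u. \<integral>\<^sup>+v. ?F \<psi> u v \<partial>lborel \<partial>lborel \<partial>N)"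
    by (rule nn_integral_mono)
  also have "\<dots> = (\<integral>\<^sup>+u. \<integral>\<^sup>+\<psi>. \<integral>\<^sup>+v. ?F \<psi> u v \<partial>lborel \<partial>N \<partial>lborel)"
    by (rule P.Fubini'[symmetric]) measurable
  also have "\<dots> = (\<integral>\<^sup>+u. \<integral>\<^sup>+v. \<integral>\<^sup>+\<psi>. ?F \<psi> u v \<partial>N \<partial>lborel \<partial>lborel)"
    by (intro nn_integral_cong P.Fubini'[symmetric]) measurable
  also have "\<dots> \<le> (\<integral>\<^sup>+u. \<integral>\<^sup>+v. ennreal (ppow_const q H ^ q) * ennreal (\<bar>f u * f v\<bar> * \<bar>u - v\<bar> powr (2 * H - 2)) \<partial>lborel \<partial>lborel)"
  proof (rule nn_integral_mono, rule nn_integral_mono_AE)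
    fix u :: real
    show "AE v in lborel. (\<integral>\<^sup>+\<psi>. ?F \<psi> u v \<partial>N) \<le> ennreal (ppow_const q H ^ q) * ennreal (\<bar>f u * f v\<bar> * \<bar>u - v\<bar> powr (2 * H - 2))"
      \<comment> \<open>The diagonal point \<open>v = u\<close>, where the overlap estimate fails,
        is a null set.\<close>
      using AE_lborel_singleton[of u]
    proof eventually_elim
      fix v assume "v \<noteq> u"
      have "(\<integral>\<^sup>+\<psi>. ?F \<psi> u v \<partial>N) = (\<integral>\<^sup>+\<psi>. ennreal \<bar>f u * f v\<bar> * ennreal (a \<psi> u * a \<psi> v) \<partial>N)"
        by (intro nn_integral_cong) (simp add: ennreal_mult[symmetric] a0 abs_mult mult_ac)
      also have "\<dots> = ennreal \<bar>f u * f v\<bar> * (\<integral>\<^sup>+\<psi>. ennreal (a \<psi> u * a \<psi> v) \<partial>N)"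
        by (rule nn_integral_cmult) measurable
      also have "\<dots> \<le> ennreal \<bar>f u * f v\<bar> * ennreal (ppow_const q H ^ q * \<bar>u - v\<bar> powr (2 * H - 2))"
        unfolding a_def N_def
        by (intro mult_left_mono nn_integral_prod_ppow_le q) (use \<open>v \<noteq> u\<close> in auto)
      also have "\<dots> = ennreal (ppow_const q H ^ q) * ennreal (\<bar>f u * f v\<bar> * \<bar>u - v\<bar> powr (2 * H - 2))"
        using ppow_const_nonneg[OF q] by (simp add: ennreal_mult[symmetric] mult_ac)
      finally show "(\<integral>\<^sup>+\<psi>. ?F \<psi> u v \<partial>N) \<le> ennreal (ppow_const q H ^ q) * ennreal (\<bar>f u * f v\<bar> * \<bar>u - v\<bar> powr (2 * H - 2))" .
    qed
  qed
  also have "\<dots> = ennreal (ppow_const q H ^ q) *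
      (\<integral>\<^sup>+u. \<integral>\<^sup>+v. ennreal (\<bar>f u * f v\<bar> * \<bar>u - v\<bar> powr (2 * H - 2)) \<partial>lborel \<partial>lborel)"
    by (simp add: nn_integral_cmult)
  finally show ?thesis by (simp add: N_def)
qed

text \<open>For fixed \<open>u\<close> in the interval, integrating \<open>|u - v|^(2H-2)\<close>
  over each side of \<open>u\<close> gives at most \<open>l^(2H-1) / (2H-1)\<close>, convergent
  since \<open>2 H - 2 > -1\<close>. The two sides give the factor 2, and the integration over
  \<open>u\<close> another factor \<open>l\<close>.\<close>

lemma nn_integral_riesz_interval:
  assumes H: "1/2 < H" and cd: "c \<le> d"
    and f [measurable]: "f \<in> borel_measurable borel" and fC: "\<And>x. \<bar>f x\<bar> \<le> C * indicator {c..d} x"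
  shows "(\<integral>\<^sup>+u. \<integral>\<^sup>+v. ennreal (\<bar>f u * f v\<bar> * \<bar>u - v\<bar> powr (2 * H - 2)) \<partial>lborel \<partial>lborel)
    \<le> ennreal (2 / (2 * H - 1) * C^2 * (d - c) powr (2 * H))"
proof -
  define l where "l = d - c"
  have l: "0 \<le> l" using cd by (simp add: l_def)
  have C: "0 \<le> C" using fC[of c] cd by simp
  \<comment> \<open>The one-sided singularity cut off at the interval length;
    \<open>P (v - u)\<close> and \<open>P (u - v)\<close> cover the two sides of the
    diagonal.\<close>
  define P where "P x = indicator {0..l} x * x powr (2 * H - 2)" for x
  have P0: "0 \<le> P x" for x by (simp add: P_def)
  have [measurable]: "P \<in> borel_measurable borel" unfolding P_def by measurable
  have IP: "(\<integral>\<^sup>+x. ennreal (P x) \<partial>lborel) = ennreal (l powr (2 * H - 1) / (2 * H - 1))"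
    unfolding P_def using nn_integral_powr_left[of "2 * H - 2" l] H l by simp
  have IPu: "(\<integral>\<^sup>+v. ennreal (P (v - u)) \<partial>lborel) = (\<integral>\<^sup>+x. ennreal (P x) \<partial>lborel)"
    "(\<integral>\<^sup>+v. ennreal (P (u - v)) \<partial>lborel) = (\<integral>\<^sup>+x. ennreal (P x) \<partial>lborel)" for u
  proof -
    show "(\<integral>\<^sup>+v. ennreal (P (v - u)) \<partial>lborel) = (\<integral>\<^sup>+x. ennreal (P x) \<partial>lborel)"
      by (subst (2) nn_integral_real_affine[where c = 1 and t = "- u"]) auto
    show "(\<integral>\<^sup>+v. ennreal (P (u - v)) \<partial>lborel) = (\<integral>\<^sup>+x. ennreal (P x) \<partial>lborel)"
      by (subst (2) nn_integral_real_affine[where c = "-1" and t = u]) auto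
  qed
  have "(\<integral>\<^sup>+u. \<integral>\<^sup>+v. ennreal (\<bar>f u * f v\<bar> * \<bar>u - v\<bar> powr (2 * H - 2)) \<partial>lborel \<partial>lborel)
      \<le> (\<integral>\<^sup>+u. \<integral>\<^sup>+v. ennreal (C^2 * indicator {c..d} u) * (ennreal (P (v - u)) + ennreal (P (u - v))) \<partial>lborel \<partial>lborel)"
  proof (intro nn_integral_mono)
    fix u v :: real
    have "\<bar>f u * f v\<bar> * \<bar>u - v\<bar> powr (2 * H - 2) \<le> C^2 * indicator {c..d} u * (P (v - u) + P (u - v))"
    proof (cases "u \<in> {c..d} \<and> v \<in> {c..d}")
      case True
      have "\<bar>f u * f v\<bar> \<le> C * C"
        unfolding abs_mult using fC[of u] fC[of v] C True by (intro mult_mono) auto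
      moreover have "\<bar>u - v\<bar> powr (2 * H - 2) \<le> P (v - u) + P (u - v)"
        using True by (auto simp: P_def l_def indicator_def abs_if)
      ultimately have "\<bar>f u * f v\<bar> * \<bar>u - v\<bar> powr (2 * H - 2) \<le> C * C * (P (v - u) + P (u - v))"
        using C by (intro mult_mono) auto
      then show ?thesis using True by (simp add: power2_eq_square)
    next
      case False
      then have "f u * f v = 0" using fC[of u] fC[of v] by (auto simp: indicator_def split: if_splits)
      then have "\<bar>f u * f v\<bar> * \<bar>u - v\<bar> powr (2 * H - 2) = 0" by simp
      moreover have "0 \<le> C^2 * indicator {c..d} u * (P (v - u) + P (u - v))"
        by (intro mult_nonneg_nonneg add_nonneg_nonneg P0) auto
      ultimately show ?thesis by linarith
    qed
    then show "ennreal (\<bar>f u * f v\<bar> * \<bar>u - v\<bar> powr (2 * H - 2))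
        \<le> ennreal (C^2 * indicator {c..d} u) * (ennreal (P (v - u)) + ennreal (P (u - v)))"
      by (simp add: ennreal_mult[symmetric] ennreal_plus[symmetric] P0 ennreal_leI del: ennreal_plus)
  qed
  also have "\<dots> = (\<integral>\<^sup>+u. ennreal (C^2) * (2 * ennreal (l powr (2 * H - 1) / (2 * H - 1))) * indicator {c..d} u \<partial>lborel)"
  proof (intro nn_integral_cong)
    fix u
    have "(\<integral>\<^sup>+v. ennreal (C^2 * indicator {c..d} u) * (ennreal (P (v - u)) + ennreal (P (u - v))) \<partial>lborel)
      = ennreal (C^2 * indicator {c..d} u) * (2 * ennreal (l powr (2 * H - 1) / (2 * H - 1)))"
      by (simp add: nn_integral_cmult nn_integral_add IPu IP mult_2[symmetric])
    then show "(\<integral>\<^sup>+v. ennreal (C^2 * indicator {c..d} u) * (ennreal (P (v - u)) + ennreal (P (u - v))) \<partial>lborel)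
      = ennreal (C^2) * (2 * ennreal (l powr (2 * H - 1) / (2 * H - 1))) * indicator {c..d} u"
      by (simp add: indicator_def)
  qed
  also have "\<dots> = ennreal (C^2) * (2 * ennreal (l powr (2 * H - 1) / (2 * H - 1))) * ennreal l"
    using cd by (simp add: nn_integral_cmult l_def)
  also have "\<dots> = ennreal (C^2 * (2 * (l powr (2 * H - 1) / (2 * H - 1))) * l)"
  proof -
    have "ennreal (C^2) * (2 * ennreal Q) * ennreal l = ennreal (C^2 * (2 * Q) * l)" if "0 \<le> Q" for Q
      using that l by (simp add: ennreal_mult ennreal_numeral[symmetric] del: ennreal_numeral)
    then show ?thesis using H by simp
  qed
  also have "C^2 * (2 * (l powr (2 * H - 1) / (2 * H - 1))) * l = 2 / (2 * H - 1) * C^2 * l powr (2 * H)"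
  proof (cases "l = 0")
    case False
    then have "l powr (2 * H) = l powr (2 * H - 1) * l"
      using l powr_add[of l "2 * H - 1" 1] by simp
    then show ?thesis by simp
  qed (use H in simp)
  finally show ?thesis by (simp add: l_def)
qed

lemma wiener_admissible_interval:
  assumes H: "1/2 < H" and cd: "c \<le> d"
    and f [measurable]: "f \<in> borel_measurable borel" and fC: "\<And>x. \<bar>f x\<bar> \<le> C * indicator {c..d} x"
  shows "wiener_admissible H f"
proof -
  have "(\<integral>\<^sup>+ p. ennreal (\<bar>f (fst p) * f (snd p)\<bar> * \<bar>fst p - snd p\<bar> powr (2 * H - 2)) \<partial>(lborel \<Otimes>\<^sub>M lborel))
      = (\<integral>\<^sup>+u. \<integral>\<^sup>+v. ennreal (\<bar>f u * f v\<bar> * \<bar>u - v\<bar> powr (2 * H - 2)) \<partial>lborel \<partial>lborel)"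
    by (subst lborel.nn_integral_fst[symmetric]) auto
  also have "\<dots> < \<infinity>"
    using nn_integral_riesz_interval[OF H cd f fC] by (auto simp: less_top[symmetric] top_unique)
  finally show ?thesis by (simp add: wiener_admissible_def)
qed

definition wiener_const :: "nat \<Rightarrow> real \<Rightarrow> real" where
  "wiener_const q H = (cqH q H)^2 * fact q * ppow_const q H ^ q * (2 / (2 * H - 1))"

lemma wiener_const_nonneg:
  assumes "q \<ge> 1" "1/2 < H" "H < 1"
  shows "0 \<le> wiener_const q H"
  unfolding wiener_const_def using assms ppow_const_nonneg[OF assms] by simp

text \<open>A single estimate for both random inputs: \<open>Z t\<close> with \<open>f\<close> the
  indicator of \<open>{0..t}\<close> and \<open>C = 1\<close>, and the noise of the estimator with
  \<open>C = K\<close> on a window of length \<open>(B - A) h\<close>.\<close>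

lemma hermite_wiener_second_moment:
  assumes M: "prob_space M" and W: "isonormal M W"
    and q: "q \<ge> 1" "1/2 < H" "H < 1" and cd: "c \<le> d"
    and f: "f \<in> borel_measurable borel" and fC: "\<And>x. \<bar>f x\<bar> \<le> C * indicator {c..d} x"
    and V: "hermite_wiener M W q H f V"
  shows "(\<integral>\<^sup>+\<omega>. ennreal ((V \<omega>)^2) \<partial>M) \<le> ennreal (wiener_const q H * C^2 * (d - c) powr (2 * H))"
proof -
  define k where "k = hermite_kernel q H f"
  define N where "N = PiM {..<q} (\<lambda>_::nat. lborel :: real measure)"
  obtain Y where Y: "chaos_integral M W q k Y" and VY: "AE \<omega> in M. V \<omega> = cqH q H * Y \<omega>"
    using V unfolding hermite_wiener_def k_def by blast
  have km [measurable]: "k \<in> borel_measurable N"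
    unfolding k_def N_def by (rule borel_measurable_hermite_kernel[OF f])
  define B where "B = ppow_const q H ^ q * (2 / (2 * H - 1) * C^2 * (d - c) powr (2 * H))"
  have B0: "0 \<le> B" unfolding B_def using q ppow_const_nonneg[OF q] by simp
  have k2: "(\<integral>\<^sup>+\<psi>. ennreal ((k \<psi>)^2) \<partial>N) \<le> ennreal B"
  proof -
    have "(\<integral>\<^sup>+\<psi>. ennreal ((k \<psi>)^2) \<partial>N) \<le> ennreal (ppow_const q H ^ q) *
      (\<integral>\<^sup>+u. \<integral>\<^sup>+v. ennreal (\<bar>f u * f v\<bar> * \<bar>u - v\<bar> powr (2 * H - 2)) \<partial>lborel \<partial>lborel)"
      unfolding k_def N_def by (rule nn_integral_hermite_kernel_square[OF q f])
    also have "\<dots> \<le> ennreal (ppow_const q H ^ q) * ennreal (2 / (2 * H - 1) * C^2 * (d - c) powr (2 * H))"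
      by (intro mult_left_mono nn_integral_riesz_interval[OF q(2) cd f fC]) auto
    also have "\<dots> = ennreal B"
      unfolding B_def using q ppow_const_nonneg[OF q] by (subst ennreal_mult) auto
    finally show ?thesis .
  qed
  \<comment> \<open>The energy bound comes before the moment bound because it also supplies the
    square integrability that the latter presupposes.\<close>
  have ki: "integrable N (\<lambda>\<psi>. (k \<psi>)^2)"
    using k2 by (intro integrableI_bounded) (auto simp: less_top[symmetric] top_unique)
  have "(\<integral>\<psi>. (k \<psi>)^2 \<partial>N) \<le> B"
    using k2 B0 by (subst integral_eq_nn_integral) (auto simp: enn2real_leI)
  moreover have "(\<integral>\<omega>. (Y \<omega>)^2 \<partial>M) \<le> fact q * (\<integral>\<psi>. (k \<psi>)^2 \<partial>N)"
    using chaos_integral_second_moment[OF M W Y] km ki by (simp add: N_def)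
  ultimately have EY: "(\<integral>\<omega>. (Y \<omega>)^2 \<partial>M) \<le> fact q * B"
    by (meson fact_ge_zero mult_left_mono order_trans)
  have Yi: "integrable M (\<lambda>\<omega>. (Y \<omega>)^2)" using Y by (simp add: chaos_integral_def)
  have "(\<integral>\<^sup>+\<omega>. ennreal ((V \<omega>)^2) \<partial>M) = (\<integral>\<^sup>+\<omega>. ennreal ((cqH q H)^2 * (Y \<omega>)^2) \<partial>M)"
    by (rule nn_integral_cong_AE) (use VY in \<open>auto simp: power_mult_distrib elim: eventually_mono\<close>)
  also have "\<dots> = ennreal (\<integral>\<omega>. (cqH q H)^2 * (Y \<omega>)^2 \<partial>M)"
    by (rule nn_integral_eq_integral) (use Yi in auto)
  also have "\<dots> \<le> ennreal ((cqH q H)^2 * (fact q * B))"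
    using EY by (intro ennreal_leI) (simp add: mult_left_mono)
  also have "(cqH q H)^2 * (fact q * B) = wiener_const q H * C^2 * (d - c) powr (2 * H)"
    by (simp add: wiener_const_def B_def)
  finally show ?thesis .
qed


section \<open>Time integrals of a continuous process\<close>

text \<open>Rounding time down to multiples of \<open>1/(n+1)\<close> leaves countably many time
  values, so each rounded process is jointly measurable; continuity of paths makes these converge
  pointwise.\<close>

lemma borel_measurable_continuous_process:
  fixes f :: "real \<Rightarrow> 'a \<Rightarrow> real"
  assumes meas: "\<And>t. f t \<in> borel_measurable M"
    and cont: "\<And>\<omega>. \<omega> \<in> space M \<Longrightarrow> continuous_on UNIV (\<lambda>t. f t \<omega>)"
  shows "(\<lambda>p. f (fst p) (snd p)) \<in> borel_measurable (borel \<Otimes>\<^sub>M M)"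
proof (rule borel_measurable_LIMSEQ_real)
  define r where "r n k = real_of_int k / real (Suc n)" for n and k :: int
  show "(\<lambda>p. f (r n \<lfloor>real (Suc n) * fst p\<rfloor>) (snd p)) \<in> borel_measurable (borel \<Otimes>\<^sub>M M)" for n
  proof (rule measurable_compose_countable[where f = "\<lambda>k p. f (r n k) (snd p)"])
    show "(\<lambda>p. f (r n k) (snd p)) \<in> borel_measurable (borel \<Otimes>\<^sub>M M)" for k
      using measurable_compose[OF measurable_snd meas] .
    show "(\<lambda>p. \<lfloor>real (Suc n) * fst p\<rfloor>) \<in> borel \<Otimes>\<^sub>M M \<rightarrow>\<^sub>M count_space UNIV"
      by measurable
  qed
  fix p assume p: "p \<in> space ((borel :: real measure) \<Otimes>\<^sub>M M)"
  have "(\<lambda>n. r n \<lfloor>real (Suc n) * fst p\<rfloor>) \<longlonglongrightarrow> fst p"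
  proof (rule LIMSEQ_I)
    fix e :: real assume e: "e > 0"
    obtain N where N: "inverse (real (Suc N)) < e" using reals_Archimedean[OF e] by auto
    show "\<exists>N. \<forall>n\<ge>N. norm (r n \<lfloor>real (Suc n) * fst p\<rfloor> - fst p) < e"
    proof (intro exI[of _ N] allI impI)
      fix n assume n: "n \<ge> N"
      have "\<bar>real_of_int \<lfloor>real (Suc n) * fst p\<rfloor> - real (Suc n) * fst p\<bar> \<le> 1" by linarith
      moreover have "r n \<lfloor>real (Suc n) * fst p\<rfloor> - fst p = (real_of_int \<lfloor>real (Suc n) * fst p\<rfloor> - real (Suc n) * fst p) / real (Suc n)"
        by (simp add: r_def diff_divide_distrib)
      ultimately have "\<bar>r n \<lfloor>real (Suc n) * fst p\<rfloor> - fst p\<bar> \<le> inverse (real (Suc n))"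
        unfolding inverse_eq_divide by (simp only: abs_divide abs_of_nat) (rule divide_right_mono, auto)
      also have "\<dots> \<le> inverse (real (Suc N))" using n by (intro le_imp_inverse_le) auto
      finally show "norm (r n \<lfloor>real (Suc n) * fst p\<rfloor> - fst p) < e" using N by simp
    qed
  qed
  moreover have "isCont (\<lambda>t. f t (snd p)) (fst p)"
    using cont[of "snd p"] p by (auto simp: space_pair_measure continuous_on_eq_continuous_at)
  ultimately show "(\<lambda>n. f (r n \<lfloor>real (Suc n) * fst p\<rfloor>) (snd p)) \<longlonglongrightarrow> f (fst p) (snd p)"
    by (rule isCont_tendsto_compose[rotated])
qed

text \<open>Cauchy-Schwarz in time gives one factor \<open>d - c\<close>, and Tonelli with the
  fixed-time variance bound gives the other. On a kernel window the resulting square of the length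
  cancels the square of the prefactor \<open>1/h\<close>.\<close>

lemma
  fixes Z :: "real \<Rightarrow> 'a \<Rightarrow> real"
  assumes "sigma_finite_measure M"
    and meas: "\<And>t. Z t \<in> borel_measurable M"
    and cont: "\<And>\<omega>. \<omega> \<in> space M \<Longrightarrow> continuous_on {0..T} (\<lambda>t. Z t \<omega>)"
    and cd: "0 \<le> c" "c \<le> d" "d \<le> T"
  shows borel_measurable_time_integral: "(\<lambda>\<omega>. integral {c..d} (\<lambda>s. \<bar>Z s \<omega>\<bar>)) \<in> borel_measurable M"
    and time_integral_second_moment:
      "\<lbrakk>0 \<le> V; \<And>t. t \<in> {0..T} \<Longrightarrow> (\<integral>\<^sup>+\<omega>. ennreal ((Z t \<omega>)^2) \<partial>M) \<le> ennreal V\<rbrakk> \<Longrightarrow>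
        (\<integral>\<^sup>+\<omega>. ennreal ((integral {c..d} (\<lambda>s. \<bar>Z s \<omega>\<bar>))^2) \<partial>M) \<le> ennreal (V * (d - c)^2)"
proof -
  interpret sigma_finite_measure M by fact
  interpret P: pair_sigma_finite "lborel :: real measure" M by standard
  \<comment> \<open>Paths are continuous only on \<open>{0..T}\<close>; clamping time extends them
    continuously to the line without changing them on \<open>{c..d}\<close>.\<close>
  define Y where "Y t \<omega> = Z (max 0 (min T t)) \<omega>" for t \<omega>
  have YZ: "Y t \<omega> = Z t \<omega>" if "t \<in> {c..d}" for t \<omega> using that cd by (simp add: Y_def)
  have Yj: "(\<lambda>p. Y (fst p) (snd p)) \<in> borel_measurable (borel \<Otimes>\<^sub>M M)"
  proof (rule borel_measurable_continuous_process)
    show "Y t \<in> borel_measurable M" for t unfolding Y_def by (rule meas)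
    show "continuous_on UNIV (\<lambda>t. Y t \<omega>)" if "\<omega> \<in> space M" for \<omega>
      unfolding Y_def
      by (rule continuous_on_compose2[OF cont[OF that], where f = "\<lambda>t. max 0 (min T t)"])
        (use cd in \<open>auto intro!: continuous_intros\<close>)
  qed
  have Ym [measurable]: "(\<lambda>x. Y (a x) (b x)) \<in> borel_measurable K"
    if "a \<in> borel_measurable K" "b \<in> measurable K M" for K :: "'k measure" and a b
    using measurable_compose[OF measurable_Pair[OF that] Yj] by simp
  have I: "ennreal (integral {c..d} (\<lambda>s. \<bar>Z s \<omega>\<bar>)) = (\<integral>\<^sup>+s. ennreal (indicator {c..d} s * \<bar>Y s \<omega>\<bar>) \<partial>lborel)"
    if "\<omega> \<in> space M" for \<omega>
  proof -
    have "continuous_on {c..d} (\<lambda>s. \<bar>Z s \<omega>\<bar>)"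
      by (intro continuous_intros continuous_on_subset[OF cont[OF that]]) (use cd in auto)
    then have "((\<lambda>s. \<bar>Z s \<omega>\<bar>) has_integral integral {c..d} (\<lambda>s. \<bar>Z s \<omega>\<bar>)) {c..d}"
      by (intro integrable_integral integrable_continuous_interval)
    then have "((\<lambda>s. \<bar>Y s \<omega>\<bar>) has_integral integral {c..d} (\<lambda>s. \<bar>Z s \<omega>\<bar>)) {c..d}"
      by (rule has_integral_eq[rotated]) (simp add: YZ)
    from nn_integral_has_integral_lebesgue[OF _ this] show ?thesis by simp
  qed
  \<comment> \<open>Valid also for \<omega> outside the space, where integrability is unknown,
    because the integral then defaults to 0.\<close>
  have I0: "0 \<le> integral {c..d} (\<lambda>s. \<bar>Z s \<omega>\<bar>)" for \<omega>
    by (cases "(\<lambda>s. \<bar>Z s \<omega>\<bar>) integrable_on {c..d}")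
      (auto intro!: Henstock_Kurzweil_Integration.integral_nonneg simp: not_integrable_integral)
  have "(\<lambda>\<omega>. enn2real (\<integral>\<^sup>+s. ennreal (indicator {c..d} s * \<bar>Y s \<omega>\<bar>) \<partial>lborel)) \<in> borel_measurable M"
    by measurable
  moreover have "enn2real (\<integral>\<^sup>+s. ennreal (indicator {c..d} s * \<bar>Y s \<omega>\<bar>) \<partial>lborel) = integral {c..d} (\<lambda>s. \<bar>Z s \<omega>\<bar>)"
    if "\<omega> \<in> space M" for \<omega>
    unfolding I[OF that, symmetric] by (simp add: I0)
  ultimately show "(\<lambda>\<omega>. integral {c..d} (\<lambda>s. \<bar>Z s \<omega>\<bar>)) \<in> borel_measurable M"
    by (subst (asm) measurable_cong) auto
  assume V: "0 \<le> V" "\<And>t. t \<in> {0..T} \<Longrightarrow> (\<integral>\<^sup>+\<omega>. ennreal ((Z t \<omega>)^2) \<partial>M) \<le> ennreal V"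
  have "(\<integral>\<^sup>+\<omega>. ennreal ((integral {c..d} (\<lambda>s. \<bar>Z s \<omega>\<bar>))^2) \<partial>M)
      \<le> (\<integral>\<^sup>+\<omega>. \<integral>\<^sup>+s. ennreal (d - c) * (indicator {c..d} s * ennreal ((Y s \<omega>)^2)) \<partial>lborel \<partial>M)"
  proof (rule nn_integral_mono)
    fix \<omega> assume \<omega>: "\<omega> \<in> space M"
    have [measurable]: "(\<lambda>s. Y s \<omega>) \<in> borel_measurable borel"
      by (rule Ym) (use \<omega> in auto)
    \<comment> \<open>The indicator is written twice so that one copy can act as the second function
      in Cauchy-Schwarz.\<close>
    have "ennreal ((integral {c..d} (\<lambda>s. \<bar>Z s \<omega>\<bar>))^2) = (\<integral>\<^sup>+s. indicator {c..d} s * (indicator {c..d} s * ennreal \<bar>Y s \<omega>\<bar>) \<partial>lborel)^2"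
      unfolding ennreal_power[OF I0, symmetric] I[OF \<omega>]
      by (intro arg_cong[where f = "\<lambda>x. x^2"] nn_integral_cong) (auto simp: indicator_def)
    also have "\<dots> \<le> (\<integral>\<^sup>+s. (indicator {c..d} s)^2 \<partial>lborel) * (\<integral>\<^sup>+s. (indicator {c..d} s * ennreal \<bar>Y s \<omega>\<bar>)^2 \<partial>lborel)"
      by (rule Cauchy_Schwarz_nn_integral) auto
    also have "(\<integral>\<^sup>+s. (indicator {c..d} s)^2 \<partial>lborel) = (\<integral>\<^sup>+s. indicator {c..d} s \<partial>(lborel :: real measure))"
      by (intro nn_integral_cong) (auto simp: indicator_def)
    also have "\<dots> = ennreal (d - c)" using cd by simp
    also have "(\<integral>\<^sup>+s. (indicator {c..d} s * ennreal \<bar>Y s \<omega>\<bar>)^2 \<partial>lborel) = (\<integral>\<^sup>+s. indicator {c..d} s * ennreal ((Y s \<omega>)^2) \<partial>lborel)"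
      by (intro nn_integral_cong) (auto simp: indicator_def ennreal_power)
    also have "ennreal (d - c) * \<dots> = (\<integral>\<^sup>+s. ennreal (d - c) * (indicator {c..d} s * ennreal ((Y s \<omega>)^2)) \<partial>lborel)"
      by (rule nn_integral_cmult[symmetric]) measurable
    finally show "ennreal ((integral {c..d} (\<lambda>s. \<bar>Z s \<omega>\<bar>))^2) \<le> (\<integral>\<^sup>+s. ennreal (d - c) * (indicator {c..d} s * ennreal ((Y s \<omega>)^2)) \<partial>lborel)" .
  qed
  also have "\<dots> = (\<integral>\<^sup>+s. \<integral>\<^sup>+\<omega>. ennreal (d - c) * (indicator {c..d} s * ennreal ((Y s \<omega>)^2)) \<partial>M \<partial>lborel)"
    by (rule P.Fubini') measurable
  also have "\<dots> \<le> (\<integral>\<^sup>+s. ennreal (d - c) * ennreal V * indicator {c..d} s \<partial>lborel)"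
  proof (rule nn_integral_mono)
    fix s
    show "(\<integral>\<^sup>+\<omega>. ennreal (d - c) * (indicator {c..d} s * ennreal ((Y s \<omega>)^2)) \<partial>M) \<le> ennreal (d - c) * ennreal V * indicator {c..d} s"
    proof (cases "s \<in> {c..d}")
      case True
      have [measurable]: "Z s \<in> borel_measurable M" by (rule meas)
      have "(\<integral>\<^sup>+\<omega>. ennreal (d - c) * (indicator {c..d} s * ennreal ((Y s \<omega>)^2)) \<partial>M) = ennreal (d - c) * (\<integral>\<^sup>+\<omega>. ennreal ((Z s \<omega>)^2) \<partial>M)"
        using True by (simp add: YZ nn_integral_cmult)
      also have "\<dots> \<le> ennreal (d - c) * ennreal V" using True cd by (intro mult_left_mono V(2)) auto
      finally show ?thesis using True by simp
    qed simp
  qed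
  also have "\<dots> = ennreal (d - c) * ennreal V * ennreal (d - c)"
    using cd by (simp add: nn_integral_cmult)
  also have "\<dots> = ennreal (V * (d - c)^2)"
    using cd V(1) by (simp add: ennreal_mult[symmetric] power2_eq_square mult_ac)
  finally show "(\<integral>\<^sup>+\<omega>. ennreal ((integral {c..d} (\<lambda>s. \<bar>Z s \<omega>\<bar>))^2) \<partial>M) \<le> ennreal (V * (d - c)^2)" .
qed


section \<open>Pathwise estimates\<close>

text \<open>Gronwall's argument in integrated form: the forcing enters through its value at
  \<open>t\<close> and its time integral, whose second moments are controllable, and not through its
  supremum.\<close>

lemma linear_equation_perturbation_bound:
  fixes D \<theta> z :: "real \<Rightarrow> real"
  assumes D: "continuous_on {0..T} D" and \<theta>: "continuous_on {0..T} \<theta>" and z: "continuous_on {0..T} z"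
    and L: "0 \<le> L" "\<And>t. \<bar>\<theta> t\<bar> \<le> L" and \<epsilon>: "0 \<le> \<epsilon>"
    and eq: "\<And>t. t \<in> {0..T} \<Longrightarrow> D t = integral {0..t} (\<lambda>s. \<theta> s * D s) + \<epsilon> * z t"
    and t: "t \<in> {0..T}"
  shows "\<bar>D t\<bar> \<le> \<epsilon> * (\<bar>z t\<bar> + L * exp (L * T) * integral {0..T} (\<lambda>s. \<bar>z s\<bar>))"
proof -
  define m where "m t = integral {0..t} (\<lambda>s. \<bar>D s\<bar>)" for t
  define J where "J t = integral {0..t} (\<lambda>s. \<bar>z s\<bar>)" for t
  \<comment> \<open>Since \<open>m' = |D|\<close> is at most \<open>L m + \<epsilon> |z|\<close>,
    the integrating factor makes \<open>w\<close> nonincreasing; it starts at 0, which bounds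
    \<open>m\<close> by a multiple of \<open>J\<close>.\<close>
  define w where "w t = exp (- L * t) * m t - \<epsilon> * J t" for t
  have Da: "continuous_on {0..T} (\<lambda>s. \<bar>D s\<bar>)" and za: "continuous_on {0..T} (\<lambda>s. \<bar>z s\<bar>)"
    by (intro continuous_intros D z)+
  have int: "(\<lambda>s. \<bar>D s\<bar>) integrable_on {0..s}" "(\<lambda>s. \<bar>z s\<bar>) integrable_on {0..s}"
    "(\<lambda>s. \<theta> s * D s) integrable_on {0..s}" if "s \<le> T" for s
    using that by (auto intro!: integrable_continuous_interval continuous_intros
        continuous_on_subset[OF D] continuous_on_subset[OF z] continuous_on_subset[OF \<theta>])
  have Dle: "\<bar>D s\<bar> \<le> L * m s + \<epsilon> * \<bar>z s\<bar>" if "s \<in> {0..T}" for s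
  proof -
    have "norm (integral {0..s} (\<lambda>s. \<theta> s * D s)) \<le> integral {0..s} (\<lambda>s. L * \<bar>D s\<bar>)"
      using that L by (intro Henstock_Kurzweil_Integration.integral_norm_bound_integral int
          integrable_on_mult_right) (auto simp: abs_mult mult_right_mono)
    also have "\<dots> = L * m s" by (simp add: m_def)
    finally have 1: "\<bar>integral {0..s} (\<lambda>s. \<theta> s * D s)\<bar> \<le> L * m s" by simp
    have "\<bar>D s\<bar> \<le> \<bar>integral {0..s} (\<lambda>s. \<theta> s * D s)\<bar> + \<epsilon> * \<bar>z s\<bar>"
      using eq[OF that] abs_triangle_ineq[of "integral {0..s} (\<lambda>s. \<theta> s * D s)" "\<epsilon> * z s"] \<epsilon>
      by (simp add: abs_mult)
    with 1 show ?thesis by linarith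
  qed
  have m0: "0 \<le> m s" if "s \<le> T" for s
    unfolding m_def by (intro Henstock_Kurzweil_Integration.integral_nonneg int that) auto
  have "w t \<le> w 0"
  proof (rule DERIV_nonpos_imp_decreasing_open[of 0 t w])
    show "0 \<le> t" using t by simp
    have "continuous_on {0..T} m" "continuous_on {0..T} J"
      unfolding m_def J_def by (intro indefinite_integral_continuous_1 int order_refl)+
    then have "continuous_on {0..T} w" unfolding w_def by (intro continuous_intros)
    then show "continuous_on {0..t} w" by (rule continuous_on_subset) (use t in auto)
    fix s assume s: "0 < s" "s < t"
    then have sT: "s \<in> {0..T}" and at: "at s within {0..T} = at s"
      using t by (auto intro!: at_within_Icc_at)
    have "(m has_real_derivative \<bar>D s\<bar>) (at s)" "(J has_real_derivative \<bar>z s\<bar>) (at s)"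
      using integral_has_real_derivative[OF Da sT] integral_has_real_derivative[OF za sT]
      unfolding at m_def J_def by auto
    then have "(w has_real_derivative exp (- L * s) * (\<bar>D s\<bar> - L * m s) - \<epsilon> * \<bar>z s\<bar>) (at s)"
      unfolding w_def by (auto intro!: derivative_eq_intros simp: algebra_simps)
    moreover have "exp (- L * s) * (\<bar>D s\<bar> - L * m s) \<le> 1 * (\<epsilon> * \<bar>z s\<bar>)"
    proof -
      have "exp (- L * s) * (\<bar>D s\<bar> - L * m s) \<le> exp (- L * s) * (\<epsilon> * \<bar>z s\<bar>)"
        using Dle[OF sT] by (intro mult_left_mono) auto
      also have "\<dots> \<le> 1 * (\<epsilon> * \<bar>z s\<bar>)"
        using L s \<epsilon> by (intro mult_right_mono) auto
      finally show ?thesis .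
    qed
    ultimately show "\<exists>y. (w has_real_derivative y) (at s) \<and> y \<le> 0" by fastforce
  qed
  then have "exp (- L * t) * m t \<le> \<epsilon> * J t" by (simp add: w_def m_def J_def)
  then have "exp (L * t) * (exp (- L * t) * m t) \<le> exp (L * t) * (\<epsilon> * J t)"
    by (intro mult_left_mono) auto
  moreover have "exp (L * t) * (exp (- L * t) * m t) = m t"
    by (simp add: mult.assoc[symmetric] exp_add[symmetric])
  moreover have "exp (L * t) * (\<epsilon> * J t) \<le> exp (L * T) * (\<epsilon> * J T)"
  proof (intro mult_mono)
    show "J t \<le> J T" unfolding J_def
      by (rule integral_subset_le) (use t int in auto)
    show "0 \<le> J t" unfolding J_def
      by (intro Henstock_Kurzweil_Integration.integral_nonneg int) (use t in auto)
    then show "0 \<le> \<epsilon> * J t" using \<epsilon> by simp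
  qed (use t L \<epsilon> in \<open>auto intro: mult_left_mono\<close>)
  ultimately have "m t \<le> exp (L * T) * (\<epsilon> * J T)" by linarith
  then have "L * m t \<le> L * (exp (L * T) * (\<epsilon> * J T))" using L by (intro mult_left_mono)
  with Dle[OF t] show ?thesis by (simp add: J_def algebra_simps)
qed

text \<open>Size and Lipschitz constants of the noiseless solution depend on \<theta> only through
  \<open>L\<close>, which makes the later bounds uniform over the class; the Lipschitz constant
  bounds the derivative \<open>\<theta> x\<close>.\<close>

lemma
  fixes \<theta> :: "real \<Rightarrow> real" and x0 :: real
  assumes \<theta>: "continuous_on {0..T} \<theta>" and L: "0 \<le> L" "\<And>t. \<bar>\<theta> t\<bar> \<le> L"
  defines "x \<equiv> \<lambda>t. x0 * exp (integral {0..t} \<theta>)"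
  shows linear_ode_continuous: "continuous_on {0..T} x"
    and linear_ode_integral_eq: "t \<in> {0..T} \<Longrightarrow> x t = x0 + integral {0..t} (\<lambda>s. \<theta> s * x s)"
    and linear_ode_bound: "t \<in> {0..T} \<Longrightarrow> \<bar>x t\<bar> \<le> \<bar>x0\<bar> * exp (L * T)"
    and linear_ode_lipschitz: "\<lbrakk>s \<in> {0..T}; t \<in> {0..T}\<rbrakk> \<Longrightarrow> \<bar>x s - x t\<bar> \<le> L * (\<bar>x0\<bar> * exp (L * T)) * \<bar>s - t\<bar>"
proof -
  have int: "\<theta> integrable_on {0..s}" if "s \<le> T" for s
    using that by (auto intro!: integrable_continuous_interval continuous_on_subset[OF \<theta>])
  have deriv: "(x has_real_derivative \<theta> s * x s) (at s within {0..T})" if "s \<in> {0..T}" for s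
    unfolding x_def
    by (rule derivative_eq_intros refl integral_has_real_derivative[OF \<theta> that])+ simp
  show cont: "continuous_on {0..T} x"
    by (rule DERIV_continuous_on[OF deriv])
  show "x t = x0 + integral {0..t} (\<lambda>s. \<theta> s * x s)" if "t \<in> {0..T}"
  proof -
    have "((\<lambda>s. \<theta> s * x s) has_integral (x t - x 0)) {0..t}"
    proof (rule fundamental_theorem_of_calculus)
      fix s assume "s \<in> {0..t}"
      then have "(x has_real_derivative \<theta> s * x s) (at s within {0..t})"
        using deriv[of s] that by (auto intro: DERIV_subset)
      then show "(x has_vector_derivative \<theta> s * x s) (at s within {0..t})"
        by (simp add: has_real_derivative_iff_has_vector_derivative)
    qed (use that in auto)
    moreover have "x 0 = x0" by (simp add: x_def)
    ultimately show ?thesis by (simp add: integral_unique)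
  qed
  show bound: "\<bar>x t\<bar> \<le> \<bar>x0\<bar> * exp (L * T)" if "t \<in> {0..T}" for t
  proof -
    have "norm (integral {0..t} \<theta>) \<le> integral {0..t} (\<lambda>_. L)"
      using that L by (intro Henstock_Kurzweil_Integration.integral_norm_bound_integral int) auto
    also have "\<dots> = L * t" using that by simp
    also have "\<dots> \<le> L * T" using that L by (intro mult_left_mono) auto
    finally have "integral {0..t} \<theta> \<le> L * T" by simp
    then show ?thesis by (simp add: x_def abs_mult mult_left_mono)
  qed
  show "\<bar>x s - x t\<bar> \<le> L * (\<bar>x0\<bar> * exp (L * T)) * \<bar>s - t\<bar>" if "s \<in> {0..T}" "t \<in> {0..T}"
  proof -
    have "norm (x s - x t) \<le> (L * (\<bar>x0\<bar> * exp (L * T))) * norm (s - t)"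
    proof (rule field_differentiable_bound[where S = "{0..T}"])
      show "norm (\<theta> r * x r) \<le> L * (\<bar>x0\<bar> * exp (L * T))" if "r \<in> {0..T}" for r
        using L bound[OF that] by (auto simp: abs_mult intro!: mult_mono)
    qed (use deriv that in auto)
    then show ?thesis by simp
  qed
qed

section \<open>Averaging against a rescaled kernel\<close>

lemma integrable_on_mult_continuous:
  fixes g u :: "real \<Rightarrow> real"
  assumes g: "g \<in> borel_measurable borel" "\<And>\<tau>. \<bar>g \<tau>\<bar> \<le> K" and u: "continuous_on {c..d} u"
  shows "(\<lambda>\<tau>. g \<tau> * u \<tau>) integrable_on {c..d}"
proof (rule measurable_bounded_by_integrable_imp_integrable[where g = "\<lambda>\<tau>. K * \<bar>u \<tau>\<bar>"])
  have "g \<in> borel_measurable (lebesgue_on {c..d})"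
    using g(1) by (intro measurable_restrict_space1 measurable_completion) simp
  then show "(\<lambda>\<tau>. g \<tau> * u \<tau>) \<in> borel_measurable (lebesgue_on {c..d})"
    by (rule borel_measurable_times[OF _ continuous_imp_measurable_on_sets_lebesgue[OF u]]) auto
  show "(\<lambda>\<tau>. K * \<bar>u \<tau>\<bar>) integrable_on {c..d}"
    by (intro integrable_continuous_interval continuous_intros u)
  show "norm (g \<tau> * u \<tau>) \<le> K * \<bar>u \<tau>\<bar>" for \<tau>
    using g(2)[of \<tau>] by (simp add: abs_mult mult_right_mono)
qed auto

locale averaging_kernel =
  fixes G :: "real \<Rightarrow> real" and A B K :: real
  assumes G_meas: "G \<in> borel_measurable borel" and G_bound: "\<And>u. \<bar>G u\<bar> \<le> K"
    and AB: "A < 0" "0 < B" and G_supp: "\<And>u. u \<notin> {A..B} \<Longrightarrow> G u = 0"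
    and G_integral: "(\<integral>u. G u \<partial>lborel) = 1"
begin

lemma K_nonneg: "0 \<le> K" using G_bound[of 0] by linarith

lemma scaled_supp:
  assumes "0 < h" "\<tau> \<notin> {t + A * h..t + B * h}"
  shows "G ((\<tau> - t) / h) = 0"
  using assms by (intro G_supp) (auto simp: field_simps)

lemma scaled_bound:
  assumes "0 < h"
  shows "\<bar>G ((\<tau> - t) / h)\<bar> \<le> K * indicator {t + A * h..t + B * h} \<tau>"
  using scaled_supp[OF assms, of \<tau> t] G_bound[of "(\<tau> - t) / h"] by (cases "\<tau> \<in> {t + A * h..t + B * h}") auto

lemma scaled_measurable: "(\<lambda>\<tau>. G ((\<tau> - t) / h)) \<in> borel_measurable borel"
  using G_meas by measurable

lemma scaled_has_integral:
  assumes h: "0 < h"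
  shows "((\<lambda>\<tau>. G ((\<tau> - t) / h)) has_integral h) {t + A * h..t + B * h}"
proof -
  have "integrable lborel G"
    \<comment> \<open>An integral equal to 1 cannot be the default value 0, so \<open>G\<close> is
      integrable.\<close>
    using G_integral not_integrable_integral_eq[of lborel G] by auto
  then have i: "integrable lborel (\<lambda>\<tau>. G (- t / h + (1 / h) * \<tau>))"
    using h by (intro lborel_integrable_real_affine) auto
  have e: "G (- t / h + (1 / h) * \<tau>) = G ((\<tau> - t) / h)" for \<tau>
    by (simp add: diff_divide_distrib)
  have "(\<integral>u. G u \<partial>lborel) = \<bar>1 / h\<bar> *\<^sub>R (\<integral>\<tau>. G (- t / h + (1 / h) * \<tau>) \<partial>lborel)"
    using h by (intro lborel_integral_real_affine) auto
  then have "(\<integral>\<tau>. G ((\<tau> - t) / h) \<partial>lborel) = h"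
    using h unfolding e G_integral by (simp add: field_simps)
  with has_integral_integral_lborel[OF i] have "((\<lambda>\<tau>. G ((\<tau> - t) / h)) has_integral h) UNIV"
    unfolding e by simp
  moreover have "(\<lambda>\<tau>. if \<tau> \<in> {t + A * h..t + B * h} then G ((\<tau> - t) / h) else 0) = (\<lambda>\<tau>. G ((\<tau> - t) / h))"
    using scaled_supp[OF h] by auto
  ultimately have "((\<lambda>\<tau>. if \<tau> \<in> {t + A * h..t + B * h} then G ((\<tau> - t) / h) else 0) has_integral h) UNIV"
    by (simp only:)
  then show ?thesis by (rule has_integral_restrict_UNIV[THEN iffD1])
qed

text \<open>When the window lies inside \<open>{0..T}\<close>, cutting off at the endpoints loses
  nothing: the kernel vanishes on the rest of the interval.\<close>

lemma scaled_integral_restrict: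
  assumes h: "0 < h" and cd: "0 \<le> t + A * h" "t + B * h \<le> T" and u: "continuous_on {0..T} u"
  shows "((\<lambda>\<tau>. G ((\<tau> - t) / h) * u \<tau>) has_integral
      integral {t + A * h..t + B * h} (\<lambda>\<tau>. G ((\<tau> - t) / h) * u \<tau>)) {0..T}"
proof (rule has_integral_on_superset)
  show "((\<lambda>\<tau>. G ((\<tau> - t) / h) * u \<tau>) has_integral
      integral {t + A * h..t + B * h} (\<lambda>\<tau>. G ((\<tau> - t) / h) * u \<tau>)) {t + A * h..t + B * h}"
    by (intro integrable_integral integrable_on_mult_continuous[where K = K] scaled_measurable
        G_bound continuous_on_subset[OF u]) (use cd in auto)
qed (use scaled_supp[OF h] cd in auto)

lemma scaled_integral_le:
  assumes h: "0 < h" and cd: "0 \<le> t + A * h" "t + B * h \<le> T" and u: "continuous_on {0..T} u"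
    and v: "v integrable_on {t + A * h..t + B * h}"
    and uv: "\<And>\<tau>. \<tau> \<in> {t + A * h..t + B * h} \<Longrightarrow> \<bar>u \<tau>\<bar> \<le> v \<tau>"
  shows "\<bar>integral {0..T} (\<lambda>\<tau>. G ((\<tau> - t) / h) * u \<tau>)\<bar> \<le> K * integral {t + A * h..t + B * h} v"
proof -
  have "norm (integral {t + A * h..t + B * h} (\<lambda>\<tau>. G ((\<tau> - t) / h) * u \<tau>)) \<le> integral {t + A * h..t + B * h} (\<lambda>\<tau>. K * v \<tau>)"
  proof (rule Henstock_Kurzweil_Integration.integral_norm_bound_integral)
    show "(\<lambda>\<tau>. G ((\<tau> - t) / h) * u \<tau>) integrable_on {t + A * h..t + B * h}"
      by (intro integrable_on_mult_continuous[where K = K] scaled_measurable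
        G_bound continuous_on_subset[OF u]) (use cd in auto)
    show "norm (G ((\<tau> - t) / h) * u \<tau>) \<le> K * v \<tau>" if "\<tau> \<in> {t + A * h..t + B * h}" for \<tau>
      unfolding real_norm_def abs_mult using uv[OF that] G_bound K_nonneg by (intro mult_mono) auto
  qed (intro integrable_on_mult_right v)
  then show ?thesis
    using integral_unique[OF scaled_integral_restrict[OF h cd u]] by simp
qed

text \<open>The kernel has mass exactly \<open>h\<close> in \<open>{0..T}\<close>, so
  \<open>u t\<close> can be moved under the integral. The remaining increment is at most
  \<open>R (B - A) h\<close> on a window of length \<open>(B - A) h\<close>, and division by
  \<open>h\<close> leaves order one in \<open>h\<close>.\<close>

lemma kernel_bias:
  assumes h: "0 < h" and cd: "0 \<le> t + A * h" "t + B * h \<le> T" and u: "continuous_on {0..T} u"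
    and R: "0 \<le> R" "\<And>\<tau>. \<tau> \<in> {0..T} \<Longrightarrow> \<bar>u \<tau> - u t\<bar> \<le> R * \<bar>\<tau> - t\<bar>"
  shows "\<bar>(1 / h) * integral {0..T} (\<lambda>\<tau>. G ((\<tau> - t) / h) * u \<tau>) - u t\<bar> \<le> K * (B - A)^2 * R * h"
proof -
  have 1: "((\<lambda>\<tau>. G ((\<tau> - t) / h)) has_integral h) {0..T}"
    by (rule has_integral_on_superset[OF scaled_has_integral[OF h]]) (use scaled_supp[OF h] cd in auto)
  note 2 = scaled_integral_restrict[OF h cd u]
  have "((\<lambda>\<tau>. G ((\<tau> - t) / h) * u \<tau> - G ((\<tau> - t) / h) * u t) has_integral
      integral {0..T} (\<lambda>\<tau>. G ((\<tau> - t) / h) * u \<tau>) - h * u t) {0..T}"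
    using 2 integral_unique[OF 2] by (intro has_integral_diff has_integral_mult_left 1) simp
  then have eq: "integral {0..T} (\<lambda>\<tau>. G ((\<tau> - t) / h) * u \<tau>) - h * u t
      = integral {0..T} (\<lambda>\<tau>. G ((\<tau> - t) / h) * (u \<tau> - u t))"
    by (simp add: right_diff_distrib integral_unique)
  have "\<bar>integral {0..T} (\<lambda>\<tau>. G ((\<tau> - t) / h) * (u \<tau> - u t))\<bar> \<le> K * integral {t + A * h..t + B * h} (\<lambda>_. R * ((B - A) * h))"
  proof (rule scaled_integral_le[OF h cd])
    show "continuous_on {0..T} (\<lambda>\<tau>. u \<tau> - u t)" by (intro continuous_intros u)
    fix \<tau> assume \<tau>: "\<tau> \<in> {t + A * h..t + B * h}"
    \<comment> \<open>As \<open>A < 0 < B\<close>, the point \<open>t\<close> itself lies in the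
      window, so distances to it are at most the window length.\<close>
    have "A * h \<le> 0" "0 \<le> B * h" using AB h by (auto simp: mult_le_0_iff)
    with \<tau> have "\<bar>\<tau> - t\<bar> \<le> (B - A) * h" by (auto simp: left_diff_distrib)
    then have "R * \<bar>\<tau> - t\<bar> \<le> R * ((B - A) * h)" using R by (intro mult_left_mono)
    then show "\<bar>u \<tau> - u t\<bar> \<le> R * ((B - A) * h)" using R(2)[of \<tau>] \<tau> cd by auto
  qed auto
  also have "\<dots> = h * (K * (B - A)^2 * R * h)"
  proof -
    have "t + A * h \<le> t + B * h" using AB h by simp
    then show ?thesis by (simp add: power2_eq_square algebra_simps)
  qed
  finally have "\<bar>integral {0..T} (\<lambda>\<tau>. G ((\<tau> - t) / h) * u \<tau>) - h * u t\<bar> / h \<le> K * (B - A)^2 * R * h"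
    unfolding eq using h by (simp add: divide_le_eq mult.commute)
  moreover have "(1 / h) * integral {0..T} (\<lambda>\<tau>. G ((\<tau> - t) / h) * u \<tau>) - u t
      = (integral {0..T} (\<lambda>\<tau>. G ((\<tau> - t) / h) * u \<tau>) - h * u t) / h"
    using h by (simp add: field_simps)
  ultimately show ?thesis using h by simp
qed

end


section \<open>Consistency of the kernel estimator\<close>

lemma power2_sum4_le: "(a + b + c + d)^2 \<le> 4 * (a^2 + b^2 + c^2 + d^2)" for a b c d :: real
proof -
  have "4 * (a^2 + b^2 + c^2 + d^2) - (a + b + c + d)^2
      = (a - b)^2 + (a - c)^2 + (a - d)^2 + (b - c)^2 + (b - d)^2 + (c - d)^2"
    by (simp add: power2_eq_square algebra_simps)
  then show ?thesis by (smt (verit) zero_le_power2)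
qed

lemma Theta0_continuous:
  assumes "\<theta> \<in> Theta0 L L1"
  shows "continuous_on S \<theta>"
proof (rule continuous_on_subset[OF lipschitz_on_continuous_on])
  have "0 \<le> L1" using assms[unfolded Theta0_def, simplified, THEN conjunct2, rule_format, of 0 1] by simp
  then show "L1-lipschitz_on UNIV \<theta>" using assms by (auto simp: Theta0_def dist_real_def intro!: lipschitz_onI)
qed simp

text \<open>A bound for one sample path: \<open>z\<close> is the path of the driving process and
  \<open>WZ\<close> is just a real number carried through. All coefficients are free of \<theta>,
  and the randomness is confined to \<open>P\<close>, \<open>J\<close> and
  \<open>WZ\<close>.\<close>

lemma (in averaging_kernel) estimator_error_bound:
  fixes X z \<theta> :: "real \<Rightarrow> real" and T L L1 \<epsilon> h t x0 WZ :: real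
  assumes L: "0 \<le> L" and L1: "0 \<le> L1" and \<epsilon>: "0 \<le> \<epsilon>" and h: "0 < h"
    and cd: "0 \<le> t + A * h" "t + B * h \<le> T" and t: "t \<in> {0..T}"
    and \<theta>: "\<theta> \<in> Theta0 L L1" and z: "continuous_on {0..T} z" and X: "continuous_on {0..T} X"
    and eq: "\<And>t. t \<in> {0..T} \<Longrightarrow> X t = x0 + integral {0..t} (\<lambda>s. \<theta> s * X s) + \<epsilon> * z t"
  defines "P \<equiv> integral {t + A * h..t + B * h} (\<lambda>s. \<bar>z s\<bar>)"
    and "J \<equiv> integral {0..T} (\<lambda>s. \<bar>z s\<bar>)"
    and "R \<equiv> (L1 + L * L) * (\<bar>x0\<bar> * exp (L * T))"
  shows "((1 / h) * integral {0..T} (\<lambda>\<tau>. G ((\<tau> - t) / h) * \<theta> \<tau> * X \<tau>) + (\<epsilon> / h) * WZ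
      - \<theta> t * (x0 * exp (integral {0..t} \<theta>)))^2
    \<le> 4 * ((K * L * \<epsilon> / h)^2 * P^2 + (K * L * \<epsilon> * (B - A) * (L * exp (L * T)))^2 * J^2
        + (\<epsilon> / h)^2 * WZ^2 + (K * (B - A)^2 * R * h)^2)"
proof -
  define x where "x t = x0 * exp (integral {0..t} \<theta>)" for t
  have \<theta>L: "\<bar>\<theta> t\<bar> \<le> L" and \<theta>Lip: "\<bar>\<theta> s - \<theta> t\<bar> \<le> L1 * \<bar>s - t\<bar>" for s t
    using \<theta> by (auto simp: Theta0_def)
  have \<theta>c: "continuous_on {0..T} \<theta>" by (rule Theta0_continuous[OF \<theta>])
  note x = linear_ode_continuous[OF \<theta>c L \<theta>L, of x0, folded x_def]
    linear_ode_integral_eq[OF \<theta>c L \<theta>L, of _ x0, folded x_def]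
    linear_ode_bound[OF \<theta>c L \<theta>L, of _ x0, folded x_def]
    linear_ode_lipschitz[OF \<theta>c L \<theta>L, of _ _ x0, folded x_def]
  define D where "D s = X s - x s" for s
  have Dc: "continuous_on {0..T} D" unfolding D_def by (intro continuous_intros X x(1))
  \<comment> \<open>By linearity the initial values cancel, and the deviation solves the same
    equation driven by the noise alone.\<close>
  have Deq: "D s = integral {0..s} (\<lambda>s. \<theta> s * D s) + \<epsilon> * z s" if "s \<in> {0..T}" for s
  proof -
    have "(\<lambda>s. \<theta> s * X s) integrable_on {0..s}" "(\<lambda>s. \<theta> s * x s) integrable_on {0..s}"
      using that by (auto intro!: integrable_continuous_interval continuous_on_mult
          continuous_on_subset[OF \<theta>c] continuous_on_subset[OF X] continuous_on_subset[OF x(1)])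
    then have "integral {0..s} (\<lambda>s. \<theta> s * D s) = integral {0..s} (\<lambda>s. \<theta> s * X s) - integral {0..s} (\<lambda>s. \<theta> s * x s)"
      unfolding D_def right_diff_distrib by (rule Henstock_Kurzweil_Integration.integral_diff)
    then show ?thesis using eq[OF that] x(2)[OF that] by (simp add: D_def)
  qed
  define C where "C = L * exp (L * T)"
  have C: "0 \<le> C" using L by (simp add: C_def)
  have D: "\<bar>D s\<bar> \<le> \<epsilon> * (\<bar>z s\<bar> + C * J)" if "s \<in> {0..T}" for s
    unfolding J_def C_def by (rule linear_equation_perturbation_bound[OF Dc \<theta>c z L \<theta>L \<epsilon> Deq that])
  have h_le: "t + A * h \<le> t + B * h" using AB h by simp
  have zi: "(\<lambda>s. \<bar>z s\<bar>) integrable_on {t + A * h..t + B * h}"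
    by (intro integrable_continuous_interval continuous_intros continuous_on_subset[OF z]) (use cd in auto)

  have gi: "((\<lambda>\<tau>. G ((\<tau> - t) / h) * u \<tau>) has_integral integral {0..T} (\<lambda>\<tau>. G ((\<tau> - t) / h) * u \<tau>)) {0..T}"
    if "continuous_on {0..T} u" for u
    using scaled_integral_restrict[OF h cd that] by (auto intro: integrable_integral has_integral_integrable)
  define I1 where "I1 = integral {0..T} (\<lambda>\<tau>. G ((\<tau> - t) / h) * (\<theta> \<tau> * D \<tau>))"
  define I2 where "I2 = integral {0..T} (\<lambda>\<tau>. G ((\<tau> - t) / h) * (\<theta> \<tau> * x \<tau>))"
  have "((\<lambda>\<tau>. G ((\<tau> - t) / h) * (\<theta> \<tau> * D \<tau>) + G ((\<tau> - t) / h) * (\<theta> \<tau> * x \<tau>)) has_integral (I1 + I2)) {0..T}"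
    unfolding I1_def I2_def by (intro has_integral_add gi continuous_intros \<theta>c Dc x(1))
  moreover have "(\<lambda>\<tau>. G ((\<tau> - t) / h) * (\<theta> \<tau> * D \<tau>) + G ((\<tau> - t) / h) * (\<theta> \<tau> * x \<tau>)) = (\<lambda>\<tau>. G ((\<tau> - t) / h) * \<theta> \<tau> * X \<tau>)"
    by (simp add: D_def fun_eq_iff algebra_simps)
  ultimately have I12: "integral {0..T} (\<lambda>\<tau>. G ((\<tau> - t) / h) * \<theta> \<tau> * X \<tau>) = I1 + I2"
    by (simp only: integral_unique)

  have "\<bar>I1\<bar> \<le> K * integral {t + A * h..t + B * h} (\<lambda>\<tau>. L * \<epsilon> * (\<bar>z \<tau>\<bar> + C * J))"
    unfolding I1_def
  proof (rule scaled_integral_le[OF h cd])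
    show "continuous_on {0..T} (\<lambda>\<tau>. \<theta> \<tau> * D \<tau>)" by (intro continuous_intros \<theta>c Dc)
    show "(\<lambda>\<tau>. L * \<epsilon> * (\<bar>z \<tau>\<bar> + C * J)) integrable_on {t + A * h..t + B * h}"
      by (intro integrable_on_mult_right integrable_add zi) auto
    fix \<tau> assume "\<tau> \<in> {t + A * h..t + B * h}"
    then have "\<tau> \<in> {0..T}" using cd by auto
    then have "\<bar>\<theta> \<tau>\<bar> * \<bar>D \<tau>\<bar> \<le> L * (\<epsilon> * (\<bar>z \<tau>\<bar> + C * J))"
      using \<theta>L D L by (intro mult_mono) auto
    then show "\<bar>\<theta> \<tau> * D \<tau>\<bar> \<le> L * \<epsilon> * (\<bar>z \<tau>\<bar> + C * J)" by (simp add: abs_mult mult.assoc)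
  qed
  \<comment> \<open>The term in \<open>J\<close> is constant over the window and gains a factor
    \<open>h\<close>, so it survives division by \<open>h\<close> unharmed; \<open>P\<close> has to
    gain its smallness later, in second moment.\<close>
  also have "integral {t + A * h..t + B * h} (\<lambda>\<tau>. L * \<epsilon> * (\<bar>z \<tau>\<bar> + C * J)) = L * \<epsilon> * (P + (B - A) * h * (C * J))"
  proof -
    have "integral {t + A * h..t + B * h} (\<lambda>\<tau>. \<bar>z \<tau>\<bar> + C * J) = P + (B - A) * h * (C * J)"
      using Henstock_Kurzweil_Integration.integral_add[OF zi integrable_const_ivl, of "C * J"] h_le
      by (simp add: P_def algebra_simps)
    then show ?thesis by (simp only: Henstock_Kurzweil_Integration.integral_mult_right)
  qed
  finally have I1: "\<bar>I1\<bar> \<le> K * (L * \<epsilon> * (P + (B - A) * h * (C * J)))" .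
  have J0: "0 \<le> J" and P0: "0 \<le> P"
    unfolding J_def P_def
    by (intro Henstock_Kurzweil_Integration.integral_nonneg zi integrable_continuous_interval continuous_intros z, simp)+

  have I2: "\<bar>(1 / h) * I2 - \<theta> t * x t\<bar> \<le> K * (B - A)^2 * R * h"
    unfolding I2_def
  proof (rule kernel_bias[OF h cd])
    show "continuous_on {0..T} (\<lambda>\<tau>. \<theta> \<tau> * x \<tau>)" by (intro continuous_intros \<theta>c x(1))
    show "0 \<le> R" unfolding R_def using L L1 by simp
    fix \<tau> assume \<tau>: "\<tau> \<in> {0..T}"
    \<comment> \<open>Origin of \<open>R\<close>: a Lipschitz constant of the product
      \<open>\<theta> x\<close>, with \<open>L1\<close> from the first factor and
      \<open>L * L\<close> from the second, both times the size of \<open>x\<close>.\<close>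
    have "\<theta> \<tau> * x \<tau> - \<theta> t * x t = (\<theta> \<tau> - \<theta> t) * x \<tau> + \<theta> t * (x \<tau> - x t)"
      by (simp add: algebra_simps)
    then have "\<bar>\<theta> \<tau> * x \<tau> - \<theta> t * x t\<bar> \<le> \<bar>\<theta> \<tau> - \<theta> t\<bar> * \<bar>x \<tau>\<bar> + \<bar>\<theta> t\<bar> * \<bar>x \<tau> - x t\<bar>"
      by (metis abs_mult abs_triangle_ineq)
    also have "\<dots> \<le> (L1 * \<bar>\<tau> - t\<bar>) * (\<bar>x0\<bar> * exp (L * T)) + L * (L * (\<bar>x0\<bar> * exp (L * T)) * \<bar>\<tau> - t\<bar>)"
      by (intro add_mono mult_mono \<theta>Lip \<theta>L x(3) x(4) \<tau> t) (use L L1 in auto)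
    also have "\<dots> = R * \<bar>\<tau> - t\<bar>" by (simp add: R_def algebra_simps)
    finally show "\<bar>\<theta> \<tau> * x \<tau> - \<theta> t * x t\<bar> \<le> R * \<bar>\<tau> - t\<bar>" .
  qed

  let ?E = "(1 / h) * (I1 + I2) + (\<epsilon> / h) * WZ - \<theta> t * x t"
  have "\<bar>?E\<bar> \<le> K * L * \<epsilon> / h * P + K * L * \<epsilon> * (B - A) * C * J + (\<epsilon> / h) * \<bar>WZ\<bar> + K * (B - A)^2 * R * h"
  proof -
    have tri: "\<bar>p + q + r\<bar> \<le> \<bar>p\<bar> + \<bar>q\<bar> + \<bar>r\<bar>" for p q r :: real by linarith
    have split: "?E = I1 / h + (\<epsilon> / h) * WZ + ((1 / h) * I2 - \<theta> t * x t)" by (simp add: add_divide_distrib)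
    have "\<bar>I1 / h\<bar> = \<bar>I1\<bar> / h" using h by simp
    also have "\<dots> \<le> K * (L * \<epsilon> * (P + (B - A) * h * (C * J))) / h"
      using I1 h by (intro divide_right_mono) auto
    also have "\<dots> = K * L * \<epsilon> / h * P + K * L * \<epsilon> * (B - A) * C * J"
      using h by (simp add: field_simps)
    finally have 1: "\<bar>I1 / h\<bar> \<le> K * L * \<epsilon> / h * P + K * L * \<epsilon> * (B - A) * C * J" .
    have 2: "\<bar>(\<epsilon> / h) * WZ\<bar> \<le> (\<epsilon> / h) * \<bar>WZ\<bar>" using h \<epsilon> by (simp add: abs_mult)
    show ?thesis unfolding split by (rule order.trans[OF tri add_mono[OF add_mono[OF 1 2] I2]])
  qed
  then have "\<bar>?E\<bar>^2 \<le> (K * L * \<epsilon> / h * P + K * L * \<epsilon> * (B - A) * C * J + (\<epsilon> / h) * \<bar>WZ\<bar> + K * (B - A)^2 * R * h)^2"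
    by (rule power_mono) simp
  then have "?E^2 \<le> (K * L * \<epsilon> / h * P + K * L * \<epsilon> * (B - A) * C * J + (\<epsilon> / h) * \<bar>WZ\<bar> + K * (B - A)^2 * R * h)^2"
    unfolding power2_abs .
  also have "\<dots> \<le> 4 * ((K * L * \<epsilon> / h * P)^2 + (K * L * \<epsilon> * (B - A) * C * J)^2 + ((\<epsilon> / h) * \<bar>WZ\<bar>)^2 + (K * (B - A)^2 * R * h)^2)"
    by (rule power2_sum4_le)
  finally show ?thesis
    unfolding I12 by (simp only: power_mult_distrib power2_abs C_def x_def)
qed

text \<open>The solution carries no measurability in \<omega>. Monotonicity of the nonnegative
  integral holds for arbitrary integrands, so the pathwise bound can be integrated, its right side
  being built from measurable functionals of \<open>Z\<close> and from \<open>WZ\<close>.\<close>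

lemma (in averaging_kernel) estimator_mean_square_error:
  fixes M :: "'a measure" and Z X :: "real \<Rightarrow> 'a \<Rightarrow> real" and WZ :: "'a \<Rightarrow> real"
    and T L L1 \<epsilon> h t x0 V Q :: real
  assumes M: "prob_space M" and L: "0 \<le> L" and L1: "0 \<le> L1" and \<epsilon>: "0 \<le> \<epsilon>" and h: "0 < h"
    and cd: "0 \<le> t + A * h" "t + B * h \<le> T" and t: "t \<in> {0..T}"
    and \<theta>: "\<theta> \<in> Theta0 L L1"
    and Z: "\<And>t. Z t \<in> borel_measurable M" "\<And>\<omega>. \<omega> \<in> space M \<Longrightarrow> continuous_on {0..T} (\<lambda>t. Z t \<omega>)"
    and V: "0 \<le> V" "\<And>t. t \<in> {0..T} \<Longrightarrow> (\<integral>\<^sup>+\<omega>. ennreal ((Z t \<omega>)^2) \<partial>M) \<le> ennreal V"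
    and WZ: "WZ \<in> borel_measurable M" "0 \<le> Q" "(\<integral>\<^sup>+\<omega>. ennreal ((WZ \<omega>)^2) \<partial>M) \<le> ennreal Q"
    and X: "\<And>\<omega>. \<omega> \<in> space M \<Longrightarrow> continuous_on {0..T} (\<lambda>t. X t \<omega>)"
      "\<And>\<omega> t. \<omega> \<in> space M \<Longrightarrow> t \<in> {0..T} \<Longrightarrow> X t \<omega> = x0 + integral {0..t} (\<lambda>s. \<theta> s * X s \<omega>) + \<epsilon> * Z t \<omega>"
  defines "R \<equiv> (L1 + L * L) * (\<bar>x0\<bar> * exp (L * T))"
  shows "(\<integral>\<^sup>+\<omega>. ennreal (((1 / h) * integral {0..T} (\<lambda>\<tau>. G ((\<tau> - t) / h) * \<theta> \<tau> * X \<tau> \<omega>) + (\<epsilon> / h) * WZ \<omega>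
      - \<theta> t * (x0 * exp (integral {0..t} \<theta>)))^2) \<partial>M)
    \<le> ennreal (4 * ((K * L * (B - A))^2 * V * (1 + (L * exp (L * T) * T)^2) * \<epsilon>^2
        + (\<epsilon> / h)^2 * Q + (K * (B - A)^2 * R)^2 * h^2))"
proof -
  interpret prob_space M by (rule M)
  define P where "P \<omega> = integral {t + A * h..t + B * h} (\<lambda>s. \<bar>Z s \<omega>\<bar>)" for \<omega>
  define J where "J \<omega> = integral {0..T} (\<lambda>s. \<bar>Z s \<omega>\<bar>)" for \<omega>
  have h_le: "t + A * h \<le> t + B * h" using AB h by simp
  have T: "0 \<le> T" using t by simp
  have sf: "sigma_finite_measure M" by (rule sigma_finite_measure_axioms)
  have [measurable]: "P \<in> borel_measurable M" "J \<in> borel_measurable M" "WZ \<in> borel_measurable M"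
    unfolding P_def J_def using borel_measurable_time_integral[OF sf Z cd(1) h_le cd(2)]
      borel_measurable_time_integral[OF sf Z order_refl T order_refl] WZ by auto
  have P: "(\<integral>\<^sup>+\<omega>. ennreal ((P \<omega>)^2) \<partial>M) \<le> ennreal (V * ((B - A) * h)^2)"
    using time_integral_second_moment[OF sf Z cd(1) h_le cd(2) V] by (simp add: P_def left_diff_distrib)
  have J: "(\<integral>\<^sup>+\<omega>. ennreal ((J \<omega>)^2) \<partial>M) \<le> ennreal (V * T^2)"
    using time_integral_second_moment[OF sf Z order_refl T order_refl V] by (simp add: J_def)
  define a where "a = (K * L * \<epsilon> / h)^2"
  define b where "b = (K * L * \<epsilon> * (B - A) * (L * exp (L * T)))^2"
  define c where "c = (\<epsilon> / h)^2"
  define d where "d = (K * (B - A)^2 * R * h)^2"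
  have [simp]: "0 \<le> a" "0 \<le> b" "0 \<le> c" "0 \<le> d" by (simp_all add: a_def b_def c_def d_def)
  have enn: "ennreal (4 * (a * p + b * q + c * r + d))
      = ennreal 4 * (ennreal a * ennreal p + ennreal b * ennreal q + ennreal c * ennreal r + ennreal d)"
    if "0 \<le> p" "0 \<le> q" "0 \<le> r" for p q r
    using that by (simp add: ennreal_mult del: ennreal_numeral distrib_left_numeral)
  have "(\<integral>\<^sup>+\<omega>. ennreal (((1 / h) * integral {0..T} (\<lambda>\<tau>. G ((\<tau> - t) / h) * \<theta> \<tau> * X \<tau> \<omega>) + (\<epsilon> / h) * WZ \<omega>
      - \<theta> t * (x0 * exp (integral {0..t} \<theta>)))^2) \<partial>M)
    \<le> (\<integral>\<^sup>+\<omega>. ennreal 4 * (ennreal a * ennreal ((P \<omega>)^2) + ennreal b * ennreal ((J \<omega>)^2) + ennreal c * ennreal ((WZ \<omega>)^2) + ennreal d) \<partial>M)"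
  proof (rule nn_integral_mono)
    fix \<omega> assume \<omega>: "\<omega> \<in> space M"
    have "((1 / h) * integral {0..T} (\<lambda>\<tau>. G ((\<tau> - t) / h) * \<theta> \<tau> * X \<tau> \<omega>) + (\<epsilon> / h) * WZ \<omega>
      - \<theta> t * (x0 * exp (integral {0..t} \<theta>)))^2 \<le> 4 * (a * (P \<omega>)^2 + b * (J \<omega>)^2 + c * (WZ \<omega>)^2 + d)"
      unfolding a_def b_def c_def d_def P_def J_def R_def
      by (rule estimator_error_bound[OF L L1 \<epsilon> h cd t \<theta> Z(2)[OF \<omega>] X(1)[OF \<omega>] X(2)[OF \<omega>]])
    then have "ennreal (((1 / h) * integral {0..T} (\<lambda>\<tau>. G ((\<tau> - t) / h) * \<theta> \<tau> * X \<tau> \<omega>) + (\<epsilon> / h) * WZ \<omega>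
      - \<theta> t * (x0 * exp (integral {0..t} \<theta>)))^2) \<le> ennreal (4 * (a * (P \<omega>)^2 + b * (J \<omega>)^2 + c * (WZ \<omega>)^2 + d))"
      by (rule ennreal_leI)
    also have "\<dots> = ennreal 4 * (ennreal a * ennreal ((P \<omega>)^2) + ennreal b * ennreal ((J \<omega>)^2) + ennreal c * ennreal ((WZ \<omega>)^2) + ennreal d)"
      by (rule enn) auto
    finally show "ennreal (((1 / h) * integral {0..T} (\<lambda>\<tau>. G ((\<tau> - t) / h) * \<theta> \<tau> * X \<tau> \<omega>) + (\<epsilon> / h) * WZ \<omega>
      - \<theta> t * (x0 * exp (integral {0..t} \<theta>)))^2)
      \<le> ennreal 4 * (ennreal a * ennreal ((P \<omega>)^2) + ennreal b * ennreal ((J \<omega>)^2) + ennreal c * ennreal ((WZ \<omega>)^2) + ennreal d)" .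
  qed
  also have "\<dots> = ennreal 4 * (ennreal a * (\<integral>\<^sup>+\<omega>. ennreal ((P \<omega>)^2) \<partial>M) + ennreal b * (\<integral>\<^sup>+\<omega>. ennreal ((J \<omega>)^2) \<partial>M)
      + ennreal c * (\<integral>\<^sup>+\<omega>. ennreal ((WZ \<omega>)^2) \<partial>M) + ennreal d)"
    by (simp add: nn_integral_cmult nn_integral_add emeasure_space_1 del: ennreal_numeral)
  also have "\<dots> \<le> ennreal 4 * (ennreal a * ennreal (V * ((B - A) * h)^2) + ennreal b * ennreal (V * T^2)
      + ennreal c * ennreal Q + ennreal d)"
    by (intro add_mono mult_left_mono P J WZ) auto
  also have "\<dots> = ennreal (4 * (a * (V * ((B - A) * h)^2) + b * (V * T^2) + c * Q + d))"
    by (rule enn[symmetric]) (use V WZ in auto)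
  \<comment> \<open>Here the \<open>h^2\<close> from the window integral cancels the
    \<open>1 / h^2\<close> inside \<open>a\<close>, leaving a term of order
    \<open>\<epsilon>^2\<close>.\<close>
  also have "a * (V * ((B - A) * h)^2) + b * (V * T^2) + c * Q + d
    = (K * L * (B - A))^2 * V * (1 + (L * exp (L * T) * T)^2) * \<epsilon>^2 + (\<epsilon> / h)^2 * Q + (K * (B - A)^2 * R)^2 * h^2"
  proof -
    define w where "w = B - A"
    show ?thesis
      unfolding a_def b_def c_def d_def w_def[symmetric] using h by (simp add: power_mult_distrib power_divide field_simps)
  qed
  finally show ?thesis .
qed


theorem theorem4p1:
  fixes M :: "'a measure"
    and W :: "(real \<Rightarrow> real) \<Rightarrow> 'a \<Rightarrow> real"
    and Z :: "real \<Rightarrow> 'a \<Rightarrow> real"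
    and WZ :: "(real \<Rightarrow> real) \<Rightarrow> 'a \<Rightarrow> real"
    and X :: "(real \<Rightarrow> real) \<Rightarrow> real \<Rightarrow> real \<Rightarrow> 'a \<Rightarrow> real"
    and G \<phi> :: "real \<Rightarrow> real"
    and T x0 L L1 H A B a b :: real
    and q :: nat
  assumes T: "T > 0" and L: "L > 0" and L1: "L1 > 0" and q: "q \<ge> 1"
    and H: "1/2 < H" "H < 1"
    and G_meas: "G \<in> borel_measurable lborel" and G_bdd: "bounded (range G)"
    and AB: "A < 0" "0 < B" and G_supp: "\<forall>u. u \<notin> {A..B} \<longrightarrow> G u = 0"
    and A2: "(\<integral>u. indicator {A..B} u * G u \<partial>lborel) = 1"
    and \<phi>_pos: "\<forall>\<epsilon>>0. \<phi> \<epsilon> > 0"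
    and \<phi>_lim: "(\<phi> \<longlongrightarrow> 0) (at_right 0)"
    and \<phi>_rate: "((\<lambda>\<epsilon>. \<epsilon>^2 * \<phi> \<epsilon> powr (2 * H - 2)) \<longlongrightarrow> 0) (at_right 0)"
    and ab: "0 < a" "a \<le> b" "b < T"
    and M: "prob_space M"
    and W: "isonormal M W"
    and Z_meas: "\<forall>t. Z t \<in> borel_measurable M"
    and Z_def: "\<forall>t\<in>{0..T}. hermite_wiener M W q H (indicator {0..t}) (Z t)"
    and Z_cont: "\<forall>\<omega>\<in>space M. continuous_on {0..T} (\<lambda>t. Z t \<omega>)"
    and WZ: "\<forall>f. wiener_admissible H f \<longrightarrow> hermite_wiener M W q H f (WZ f)"
    and X_sol: "\<forall>\<theta>\<in>Theta0 L L1. \<forall>\<epsilon>>0. \<forall>\<omega>\<in>space M.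
        continuous_on {0..T} (\<lambda>t. X \<theta> \<epsilon> t \<omega>) \<and>
        (\<forall>t\<in>{0..T}. X \<theta> \<epsilon> t \<omega> =
            x0 + integral {0..t} (\<lambda>s. \<theta> s * X \<theta> \<epsilon> s \<omega>) + \<epsilon> * Z t \<omega>)"
  shows "((\<lambda>\<epsilon>. SUP \<theta>\<in>Theta0 L L1. SUP t\<in>{a..b}.
            \<integral>\<^sup>+ \<omega>. ennreal ((
               (1 / \<phi> \<epsilon>) * integral {0..T} (\<lambda>\<tau>. G ((\<tau> - t) / \<phi> \<epsilon>) * \<theta> \<tau> * X \<theta> \<epsilon> \<tau> \<omega>)
               + (\<epsilon> / \<phi> \<epsilon>) * WZ (\<lambda>\<tau>. G ((\<tau> - t) / \<phi> \<epsilon>) * indicator {0..T} \<tau>) \<omega>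
               - \<theta> t * (x0 * exp (integral {0..t} \<theta>)))^2) \<partial>M)
          \<longlongrightarrow> 0) (at_right 0)"
proof -
  interpret prob_space M by (rule M)
  obtain K where K: "\<And>u. \<bar>G u\<bar> \<le> K"
    using G_bdd by (auto simp: bounded_iff)
  have "(\<integral>u. G u \<partial>lborel) = (\<integral>u. indicator {A..B} u * G u \<partial>lborel)"
    using G_supp by (intro Bochner_Integration.integral_cong) (auto simp: indicator_def)
  then interpret averaging_kernel G A B K
    using G_meas G_supp AB A2 K by unfold_locales auto
  define w where "w = wiener_const q H"
  have w: "0 \<le> w" unfolding w_def by (rule wiener_const_nonneg[OF q H])
  define V where "V = w * T powr (2 * H)"
  define Q where "Q h = w * K^2 * ((B - A) * h) powr (2 * H)" for h
  define R where "R = (L1 + L * L) * (\<bar>x0\<bar> * exp (L * T))"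
  define \<beta> where "\<beta> \<epsilon> = 4 * ((K * L * (B - A))^2 * V * (1 + (L * exp (L * T) * T)^2) * \<epsilon>^2
        + (\<epsilon> / \<phi> \<epsilon>)^2 * Q (\<phi> \<epsilon>) + (K * (B - A)^2 * R)^2 * (\<phi> \<epsilon>)^2)" for \<epsilon>
  have V0: "0 \<le> V" and Q0: "0 \<le> Q h" for h using w by (simp_all add: V_def Q_def)
  have Z2: "(\<integral>\<^sup>+\<omega>. ennreal ((Z t \<omega>)^2) \<partial>M) \<le> ennreal V" if "t \<in> {0..T}" for t
  proof -
    have "(\<integral>\<^sup>+\<omega>. ennreal ((Z t \<omega>)^2) \<partial>M) \<le> ennreal (wiener_const q H * 1^2 * (t - 0) powr (2 * H))"
      by (rule hermite_wiener_second_moment[OF M W q H, where f = "indicator {0..t}"])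
        (use that Z_def in auto)
    also have "\<dots> \<le> ennreal V"
      unfolding V_def w_def[symmetric] using that w H by (intro ennreal_leI) (auto intro!: mult_left_mono powr_mono2)
    finally show ?thesis .
  qed

  let ?S = "\<lambda>\<epsilon>. SUP \<theta>\<in>Theta0 L L1. SUP t\<in>{a..b}.
            \<integral>\<^sup>+ \<omega>. ennreal ((
               (1 / \<phi> \<epsilon>) * integral {0..T} (\<lambda>\<tau>. G ((\<tau> - t) / \<phi> \<epsilon>) * \<theta> \<tau> * X \<theta> \<epsilon> \<tau> \<omega>)
               + (\<epsilon> / \<phi> \<epsilon>) * WZ (\<lambda>\<tau>. G ((\<tau> - t) / \<phi> \<epsilon>) * indicator {0..T} \<tau>) \<omega>
               - \<theta> t * (x0 * exp (integral {0..t} \<theta>)))^2) \<partial>M"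
  \<comment> \<open>Both suprema are handled at once because \<open>\<beta> \<epsilon>\<close>
    involves neither \<theta> nor \<open>t\<close>. The smallness conditions keep the window of
    every \<open>t\<close> in \<open>{a..b}\<close> inside \<open>{0..T}\<close>.\<close>
  have le: "?S \<epsilon> \<le> ennreal (\<beta> \<epsilon>)" if \<epsilon>: "0 < \<epsilon>" and small: "- A * \<phi> \<epsilon> \<le> a" "B * \<phi> \<epsilon> \<le> T - b" for \<epsilon>
  proof (intro SUP_least)
    fix \<theta> t assume \<theta>: "\<theta> \<in> Theta0 L L1" and t: "t \<in> {a..b}"
    define h where "h = \<phi> \<epsilon>"
    define f where "f \<tau> = G ((\<tau> - t) / h) * indicator {0..T} \<tau>" for \<tau>
    have h: "0 < h" using \<phi>_pos \<epsilon> by (simp add: h_def)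
    have cd: "0 \<le> t + A * h" "t + B * h \<le> T" using small t by (auto simp: h_def)
    have AB_le: "t + A * h \<le> t + B * h" using AB h by simp
    have t0: "t \<in> {0..T}" using t ab by auto
    have f_meas: "f \<in> borel_measurable borel"
      unfolding f_def by (intro borel_measurable_times scaled_measurable) auto
    have f_le: "\<bar>f \<tau>\<bar> \<le> K * indicator {t + A * h..t + B * h} \<tau>" for \<tau>
    proof -
      have "\<bar>f \<tau>\<bar> \<le> \<bar>G ((\<tau> - t) / h)\<bar>" by (simp add: f_def indicator_def)
      with scaled_bound[OF h, of \<tau> t] show ?thesis by linarith
    qed
    have f: "hermite_wiener M W q H f (WZ f)"
      using WZ wiener_admissible_interval[OF H(1) AB_le f_meas f_le] by blast
    have WZm: "WZ f \<in> borel_measurable M" using f by (simp add: hermite_wiener_def)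
    have WZ2: "(\<integral>\<^sup>+\<omega>. ennreal ((WZ f \<omega>)^2) \<partial>M) \<le> ennreal (Q h)"
      using hermite_wiener_second_moment[OF M W q H AB_le f_meas f_le f]
      by (simp add: Q_def w_def left_diff_distrib)
    have Xc: "continuous_on {0..T} (\<lambda>t. X \<theta> \<epsilon> t \<omega>)"
      and Xe: "t \<in> {0..T} \<Longrightarrow> X \<theta> \<epsilon> t \<omega> = x0 + integral {0..t} (\<lambda>s. \<theta> s * X \<theta> \<epsilon> s \<omega>) + \<epsilon> * Z t \<omega>"
      if "\<omega> \<in> space M" for \<omega> t
      using X_sol \<theta> \<epsilon> that by blast+
    have Zm: "Z t \<in> borel_measurable M" and Zc: "\<omega> \<in> space M \<Longrightarrow> continuous_on {0..T} (\<lambda>t. Z t \<omega>)" for t \<omega>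
      using Z_meas Z_cont by blast+
    show "(\<integral>\<^sup>+ \<omega>. ennreal ((
               (1 / \<phi> \<epsilon>) * integral {0..T} (\<lambda>\<tau>. G ((\<tau> - t) / \<phi> \<epsilon>) * \<theta> \<tau> * X \<theta> \<epsilon> \<tau> \<omega>)
               + (\<epsilon> / \<phi> \<epsilon>) * WZ (\<lambda>\<tau>. G ((\<tau> - t) / \<phi> \<epsilon>) * indicator {0..T} \<tau>) \<omega>
               - \<theta> t * (x0 * exp (integral {0..t} \<theta>)))^2) \<partial>M) \<le> ennreal (\<beta> \<epsilon>)"
      unfolding \<beta>_def R_def h_def[symmetric] f_def[abs_def, symmetric]
      by (rule estimator_mean_square_error[OF M less_imp_le[OF L] less_imp_le[OF L1] less_imp_le[OF \<epsilon>] h cd t0 \<theta>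
            Zm Zc V0 Z2 WZm Q0 WZ2 Xc Xe])
  qed

  have pos: "\<forall>\<^sub>F \<epsilon> in at_right 0. (0::real) < \<epsilon>" by (rule eventually_at_right_less)
  have lim: "((\<lambda>\<epsilon>. - A * \<phi> \<epsilon>) \<longlongrightarrow> - A * 0) (at_right 0)" "((\<lambda>\<epsilon>. B * \<phi> \<epsilon>) \<longlongrightarrow> B * 0) (at_right 0)"
    by (intro tendsto_mult tendsto_const \<phi>_lim)+
  have small: "\<forall>\<^sub>F \<epsilon> in at_right 0. - A * \<phi> \<epsilon> < a" "\<forall>\<^sub>F \<epsilon> in at_right 0. B * \<phi> \<epsilon> < T - b"
    using order_tendstoD(2)[OF lim(1), of a] order_tendstoD(2)[OF lim(2), of "T - b"] ab by simp_all
  have upper: "\<forall>\<^sub>F \<epsilon> in at_right 0. ?S \<epsilon> \<le> ennreal (\<beta> \<epsilon>)"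
    using pos small by eventually_elim (rule le, auto)

  \<comment> \<open>The same bound with its noise term rewritten by
    \<open>(\<epsilon>/h)^2 h^(2H) = \<epsilon>^2 h^(2H-2)\<close>, the quantity that the bandwidth
    condition sends to 0.\<close>
  define \<gamma> where "\<gamma> \<epsilon> = 4 * ((K * L * (B - A))^2 * V * (1 + (L * exp (L * T) * T)^2) * \<epsilon>^2
        + w * K^2 * (B - A) powr (2 * H) * (\<epsilon>^2 * \<phi> \<epsilon> powr (2 * H - 2)) + (K * (B - A)^2 * R)^2 * (\<phi> \<epsilon>)^2)" for \<epsilon>
  have "(\<gamma> \<longlongrightarrow> 4 * ((K * L * (B - A))^2 * V * (1 + (L * exp (L * T) * T)^2) * 0^2
        + w * K^2 * (B - A) powr (2 * H) * 0 + (K * (B - A)^2 * R)^2 * 0^2)) (at_right 0)"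
    unfolding \<gamma>_def by (intro tendsto_intros \<phi>_lim \<phi>_rate)
  then have \<gamma>: "(\<gamma> \<longlongrightarrow> 0) (at_right 0)" by simp
  have "\<forall>\<^sub>F \<epsilon> in at_right 0. \<gamma> \<epsilon> = \<beta> \<epsilon>"
    using pos
  proof eventually_elim
    fix \<epsilon> :: real assume "0 < \<epsilon>"
    define h where "h = \<phi> \<epsilon>"
    have h: "0 < h" using \<phi>_pos \<open>0 < \<epsilon>\<close> by (simp add: h_def)
    have "((B - A) * h) powr (2 * H) = (B - A) powr (2 * H) * (h powr (2 * H - 2) * h^2)"
      using AB h by (simp add: powr_mult powr_diff)
    then have "(\<epsilon> / h)^2 * Q h = w * K^2 * (B - A) powr (2 * H) * (\<epsilon>^2 * h powr (2 * H - 2))"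
      using h by (simp add: Q_def power_divide)
    then show "\<gamma> \<epsilon> = \<beta> \<epsilon>" by (simp add: \<gamma>_def \<beta>_def h_def)
  qed
  with \<gamma> have "(\<beta> \<longlongrightarrow> 0) (at_right 0)" by (rule Lim_transform_eventually)
  then have "((\<lambda>\<epsilon>. ennreal (\<beta> \<epsilon>)) \<longlongrightarrow> 0) (at_right 0)"
    using tendsto_ennrealI[of \<beta> 0] by simp
  from tendsto_sandwich[OF _ upper tendsto_const this] show ?thesis by simp
qed

end
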